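(* Let $k\ge1$ be an integer and let $A^{-1}$ be the $(k+1)\times(k+1)$ matrix given in the context. Then $$q^{-\frac{(2k-1)^2}{8(2k+1)}}\,\frac{(-q)_\infty}{(q)_\infty}\sum_{n\in\mathbb{Z}}(2n+1)\,q^{\frac{2k+1}{2}\left(n+\frac{2k-1}{2(2k+1)}\right)^2}$$ $$=\sum_{\substack{n_1,n_2,\dots,n_{k+1}\ge0\\ n_k\equiv n_{k+1}\ (\mathrm{mod}\ 2)}}\frac{q^{\frac12\,\boldsymbol{n}^T\cdot A^{-1}\cdot\boldsymbol{n}+\frac12n_1+\frac32n_2+\cdots+\frac{2k-3}{2}n_{k-1}+\frac{2k-1}{4}(n_k+n_{k+1})}\,(-q)_{n_1+n_2+\cdots+n_{k-1}+\frac{n_k+n_{k+1}}{2}}}{(q)_{n_1}(q)_{n_2}\cdots(q)_{n_{k+1}}},$$ where $\boldsymbol{n}=(n_1,\dots,n_{k+1})^T$.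
   Context: Conventions: $q=e^{2\pi i\tau}$ with $\operatorname{Im}\tau>0$ (so $|q|<1$), and $q^r:=e^{2\pi i r\tau}$ for rational $r$. The $q$-Pochhammer symbols are $(a)_n=(a;q)_n:=\prod_{j=1}^n(1-aq^{j-1})$ for $n\ge0$, $(a)_\infty:=\prod_{j\ge1}(1-aq^{j-1})$. The symmetric $(k+1)\times(k+1)$ matrix $A^{-1}$ has entries $(A^{-1})_{r,s}=\min\{2r-1,2s-1\}$ for $1\le r,s\le k-1$; $(A^{-1})_{r,s}=(A^{-1})_{s,r}=\frac{2s-1}{2}$ for $1\le s\le k-1$ and $r\in\{k,k+1\}$; $(A^{-1})_{k,k}=(A^{-1})_{k+1,k+1}=\frac{2k+1}{4}$; $(A^{-1})_{k,k+1}=(A^{-1})_{k+1,k}=\frac{2k-3}{4}$. For $k=1$ this is $\begin{pmatrix}\frac34&-\frac14\\-\frac14&\frac34\end{pmatrix}$. For $k\ge2$ it is the inverse of $A=\frac12(D_{k+1}+E_{1,1})$, where $D_{k+1}$ is the Cartan matrix of type $D_{k+1}$ (with the last two nodes $k$ and $k+1$ both attached to node $k-1$) and $E_{1,1}$ is the matrix unit. The linear expression $\frac12n_1+\frac32n_2+\cdots+\frac{2k-3}{2}n_{k-1}$ means $\sum_{j=1}^{k-1}\frac{2j-1}{2}n_j$, which is zero when $k=1$. *)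

theory Defs
  imports "HOL-Analysis.Analysis" "HOL-Number_Theory.Cong"
begin

text \<open>The power \<open>q\<^sup>r\<close> with \<open>q = exp (2 \<pi> i \<tau>)\<close> is defined through \<open>\<tau>\<close>, since a
  fractional power of the complex number \<open>q\<close> alone would depend on a choice of branch.\<close>

definition qpow :: "complex \<Rightarrow> real \<Rightarrow> complex" where
  "qpow \<tau> r = exp (2 * of_real pi * \<i> * of_real r * \<tau>)"

definition qpoch :: "complex \<Rightarrow> complex \<Rightarrow> nat \<Rightarrow> complex" where
  "qpoch a q n = (\<Prod>j=1..n. 1 - a * q ^ (j - 1))"

text \<open>The library's infinite products start at index 0, so \<open>j\<close> here is \<open>j - 1\<close> above.\<close>

definition qpoch_inf :: "complex \<Rightarrow> complex \<Rightarrow> complex" where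
  "qpoch_inf a q = (\<Prod>j. 1 - a * q ^ j)"

lemma convergent_prod_qpoch_inf:
  assumes "norm q < 1"
  shows "convergent_prod (\<lambda>j. 1 - a * q ^ j :: complex)"
proof -
  have "summable (\<lambda>j. norm ((1 - a * q ^ j) - 1))"
    using assms by (simp add: norm_mult norm_power summable_mult summable_geometric)
  then show ?thesis
    by (intro abs_convergent_prod_imp_convergent_prod summable_imp_abs_convergent_prod)
qed

text \<open>The matrix \<open>A\<^sup>-\<^sup>1\<close>, with rows and columns indexed by \<open>{1..k+1}\<close>; values outside this
  range are irrelevant.\<close>

definition Ainv :: "nat \<Rightarrow> nat \<Rightarrow> nat \<Rightarrow> real" where
  "Ainv k r s =
    (if r < k \<and> s < k then min (2 * real r - 1) (2 * real s - 1)
     else if s < k then (2 * real s - 1) / 2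
     else if r < k then (2 * real r - 1) / 2
     else if r = s then (2 * real k + 1) / 4
     else (2 * real k - 3) / 4)"

definition Ainv_form :: "nat \<Rightarrow> (nat \<Rightarrow> nat) \<Rightarrow> real" where
  "Ainv_form k n = (\<Sum>r=1..k+1. \<Sum>s=1..k+1. real (n r) * Ainv k r s * real (n s))"

text \<open>The vectors \<open>(n\<^sub>1, \<dots>, n\<^sub>k\<^sub>+\<^sub>1)\<close> of natural numbers, as extensional functions on
  \<open>{1..k+1}\<close>, whose last two entries have the same parity.\<close>

definition index_vectors :: "nat \<Rightarrow> (nat \<Rightarrow> nat) set" where
  "index_vectors k = {n \<in> {1..k+1} \<rightarrow>\<^sub>E UNIV. [n k = n (k + 1)] (mod 2)}"

definition theta_summand :: "complex \<Rightarrow> nat \<Rightarrow> int \<Rightarrow> complex" where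
  "theta_summand \<tau> k n =
     of_int (2 * n + 1) *
     qpow \<tau> ((2 * real k + 1) / 2 *
              (real_of_int n + (2 * real k - 1) / (2 * (2 * real k + 1))) ^ 2)"

text \<open>The \<open>div\<close> below is exact on \<^term>\<open>index_vectors k\<close>.\<close>

definition nahm_summand :: "complex \<Rightarrow> nat \<Rightarrow> (nat \<Rightarrow> nat) \<Rightarrow> complex" where
  "nahm_summand \<tau> k n =
     (let q = qpow \<tau> 1 in
      qpow \<tau> (1 / 2 * Ainv_form k n
               + (\<Sum>j=1..k-1. (2 * real j - 1) / 2 * real (n j))
               + (2 * real k - 1) / 4 * (real (n k) + real (n (k + 1))))
      * qpoch (- q) q ((\<Sum>j=1..k-1. n j) + (n k + n (k + 1)) div 2)
      / (\<Prod>j=1..k+1. qpoch q q (n j)))"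

end

theory Submission
  imports Defs "HOL-Library.Nat_Bijection"
begin

text \<open>
  The identity is an instance of the Bailey chain relative to \<open>q\<close>. With the partial sums
  \<open>N\<^sub>i = n\<^sub>i + \<cdots> + n\<^bsub>k-1\<^esub> + (n\<^sub>k + n\<^bsub>k+1\<^esub>) / 2\<close> the exponent on the right-hand side becomes
  \<open>N\<^sub>1 (N\<^sub>1 + 1) / 2 + \<Sum>\<^bsub>2\<le>j\<le>k\<^esub> (N\<^sub>j\<^sup>2 + N\<^sub>j) + ((n\<^sub>k - n\<^bsub>k+1\<^esub>) / 2)\<^sup>2\<close> (lemma \<open>nahm_exponent\<close>), so that
  the right-hand side is a nested sum over \<open>N\<^sub>1 \<ge> \<cdots> \<ge> N\<^sub>k \<ge> 0\<close>.

  The innermost sum, over \<open>n\<^sub>k + n\<^bsub>k+1\<^esub> = 2 N\<^sub>k\<close>, equals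
  \<open>\<Sum>\<^bsub>r\<le>n\<^esub> \<alpha>\<^sub>r / ((q)\<^bsub>n-r\<^esub> (q)\<^bsub>n+r+1\<^esub>)\<close> for \<open>n = N\<^sub>k\<close> and
  \<open>\<alpha>\<^sub>r = (2 r + 1) q\<^bsup>r\<^sup>2\<^esup> (1 - q\<^bsup>2r+1\<^esup>)\<close>, by summation by parts (\<open>seed_Bailey_pair\<close>). Each of the
  \<open>k - 1\<close> sums over \<open>N\<^sub>k, \<dots>, N\<^sub>2\<close> is a Bailey step, which multiplies \<open>\<alpha>\<^sub>r\<close> by \<open>q\<^bsup>r\<^sup>2+r\<^esup>\<close>
  (\<open>Bailey_step\<close>, \<open>tail_sum_eq\<close>). All these sums are finite. Convergence matters only for the
  outermost sum, over \<open>N\<^sub>1\<close>, which is interchanged with the one over \<open>r\<close> and evaluated by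
  \<open>\<Sum>\<^bsub>N\<ge>r\<^esub> (-q)\<^sub>N q\<^bsup>N(N+1)/2\<^esup> / ((q)\<^bsub>N-r\<^esub> (q)\<^bsub>N+r+1\<^esub>) = q\<^bsup>r(r+1)/2\<^esup> (-q)\<^sub>\<infinity> / (q)\<^sub>\<infinity>\<close>, a limiting case of
  the q-Gauss sum (\<open>Gauss_term_sums\<close>). There remains
  \<open>(-q)\<^sub>\<infinity> / (q)\<^sub>\<infinity> \<Sum>\<^bsub>r\<ge>0\<^esub> (2 r + 1) q\<^bsup>((2k+1)r\<^sup>2+(2k-1)r)/2\<^esup> (1 - q\<^bsup>2r+1\<^esup>)\<close>, and the terms for \<open>r\<close> are those of the
  theta series at \<open>n = r\<close> and \<open>n = - r - 1\<close> (\<open>theta_sum_eq\<close>).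
\<close>

section \<open>Finite and infinite q-Pochhammer symbols\<close>

lemma qpoch_0 [simp]: "qpoch a q 0 = 1"
  by (simp add: qpoch_def)

lemma qpoch_Suc: "qpoch a q (Suc n) = qpoch a q n * (1 - a * q ^ n)"
  by (simp add: qpoch_def)

lemma one_minus_power_nonzero:
  fixes q :: complex
  assumes "norm q < 1" "n > 0"
  shows "1 - q ^ n \<noteq> 0"
proof
  assume "1 - q ^ n = 0"
  then have "norm q ^ n = 1"
    by (metis eq_iff_diff_eq_0 norm_one norm_power)
  moreover have "norm q ^ n < 1"
    using assms by (simp add: power_less_one_iff)
  ultimately show False by simp
qed

lemma qpoch_nonzero:
  assumes "norm q < 1"
  shows "qpoch q q n \<noteq> 0"
proof (induction n)
  case (Suc n)
  then show ?case
    using one_minus_power_nonzero[OF assms, of "Suc n"] by (simp add: qpoch_Suc)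
qed simp

lemma qpoch_LIMSEQ:
  assumes "norm q < 1"
  shows "(\<lambda>n. qpoch a q n) \<longlonglongrightarrow> qpoch_inf a q"
proof -
  have "(\<lambda>n. qpoch a q (Suc n)) = (\<lambda>n. \<Prod>j\<le>n. 1 - a * q ^ j)"
  proof
    fix n show "qpoch a q (Suc n) = (\<Prod>j\<le>n. 1 - a * q ^ j)"
      by (induction n) (simp_all add: qpoch_Suc)
  qed
  then have "(\<lambda>n. qpoch a q (Suc n)) \<longlonglongrightarrow> qpoch_inf a q"
    using convergent_prod_LIMSEQ[OF convergent_prod_qpoch_inf[OF assms, of a]]
    by (simp add: qpoch_inf_def)
  then show ?thesis
    by (rule LIMSEQ_imp_Suc)
qed

lemma qpoch_inf_nonzero:
  assumes "norm q < 1"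
  shows "qpoch_inf q q \<noteq> 0"
  unfolding qpoch_inf_def
proof (rule prodinf_nonzero[OF convergent_prod_qpoch_inf[OF assms]])
  show "1 - q * q ^ i \<noteq> 0" for i
    using one_minus_power_nonzero[OF assms, of "Suc i"] by simp
qed

lemma inverse_qpoch_LIMSEQ:
  assumes "norm q < 1"
  shows "(\<lambda>n. 1 / qpoch q q n) \<longlonglongrightarrow> 1 / qpoch_inf q q"
  by (intro tendsto_divide tendsto_const qpoch_LIMSEQ qpoch_inf_nonzero assms)

lemma qpoch_bounds:
  assumes "norm q < 1"
  obtains C where "C > 0" "\<And>n. norm (qpoch (- q) q n) \<le> C" "\<And>n. norm (1 / qpoch q q n) \<le> C"
proof -
  obtain K where K: "\<And>n. norm (qpoch (- q) q n) \<le> K"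
    using convergent_imp_Bseq[OF convergentI[OF qpoch_LIMSEQ[OF assms]]] by (meson Bseq_def)
  obtain L where L: "\<And>n. norm (1 / qpoch q q n) \<le> L"
    using convergent_imp_Bseq[OF convergentI[OF inverse_qpoch_LIMSEQ[OF assms]]] by (meson Bseq_def)
  show ?thesis
  proof (rule that[of "max 1 (max K L)"])
    show "norm (qpoch (- q) q n) \<le> max 1 (max K L)" for n
      using K[of n] by linarith
    show "norm (1 / qpoch q q n) \<le> max 1 (max K L)" for n
      using L[of n] by linarith
  qed simp
qed

section \<open>The Bailey lemma relative to q\<close>

text \<open>The q-Chu-Vandermonde sum. The induction step multiplies the summand by
  \<open>1 - q\<^bsup>L+1\<^esup> = (1 - q\<^bsup>L+1-j\<^esup>) + q\<^bsup>L+1-j\<^esup> (1 - q\<^bsup>j\<^esup>)\<close>; the first part gives the sum for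
  \<open>(L, c)\<close> and the second, after a shift of \<open>j\<close>, \<open>q\<^bsup>L+1+c\<^esup>\<close> times the sum for
  \<open>(L, c + 1)\<close>.\<close>

lemma q_Vandermonde:
  assumes q: "norm q < 1"
  shows "(\<Sum>j\<le>L. q ^ (j ^ 2 + c * j) / (qpoch q q (L - j) * qpoch q q j * qpoch q q (j + c)))
       = 1 / (qpoch q q L * qpoch q q (L + c))"
proof (induction L arbitrary: c)
  case (Suc L)
  note nz = qpoch_nonzero[OF q]
  define f where "f L c j = q ^ (j ^ 2 + c * j) / (qpoch q q (L - j) * qpoch q q j * qpoch q q (j + c))"
    for L c j
  have 1: "(1 - q ^ (Suc L - j)) * f (Suc L) c j = f L c j" if "j \<le> L" for j
  proof -
    have "qpoch q q (Suc L - j) = qpoch q q (L - j) * (1 - q ^ (Suc L - j))"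
      using that by (simp add: Suc_diff_le qpoch_Suc)
    moreover have "1 - q ^ (Suc L - j) \<noteq> 0"
      using one_minus_power_nonzero[OF q, of "Suc L - j"] that by simp
    ultimately show ?thesis
      by (simp add: f_def)
  qed
  have 2: "q ^ (L - j) * (1 - q ^ Suc j) * f (Suc L) c (Suc j) = q ^ (Suc L + c) * f L (Suc c) j"
    if "j \<le> L" for j
  proof -
    have "L - j + ((Suc j)\<^sup>2 + c * Suc j) = (Suc L + c) + (j\<^sup>2 + Suc c * j)"
      using that by (simp add: power2_eq_square algebra_simps)
    then have "q ^ (L - j) * q ^ ((Suc j)\<^sup>2 + c * Suc j) = q ^ (Suc L + c) * q ^ (j\<^sup>2 + Suc c * j)"
      by (metis power_add)
    moreover have "qpoch q q (Suc j) = qpoch q q j * (1 - q ^ Suc j)"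
      by (simp add: qpoch_Suc)
    moreover have "1 - q ^ Suc j \<noteq> 0"
      using one_minus_power_nonzero[OF q, of "Suc j"] by simp
    ultimately show ?thesis
      by (simp add: f_def divide_simps nz)
  qed
  have "(1 - q ^ Suc L) * (\<Sum>j\<le>Suc L. f (Suc L) c j)
      = (\<Sum>j\<le>Suc L. (1 - q ^ (Suc L - j)) * f (Suc L) c j
                  + q ^ (Suc L - j) * (1 - q ^ j) * f (Suc L) c j)"
    unfolding sum_distrib_left
  proof (rule sum.cong)
    fix j assume "j \<in> {..Suc L}"
    then have "q ^ Suc L = q ^ (Suc L - j) * q ^ j"
      by (metis atMost_iff le_add_diff_inverse2 power_add)
    then show "(1 - q ^ Suc L) * f (Suc L) c j = (1 - q ^ (Suc L - j)) * f (Suc L) c j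
                  + q ^ (Suc L - j) * (1 - q ^ j) * f (Suc L) c j"
      by (simp only:) (simp add: algebra_simps)
  qed simp
  also have "\<dots> = (\<Sum>j\<le>Suc L. (1 - q ^ (Suc L - j)) * f (Suc L) c j)
                + (\<Sum>j\<le>Suc L. q ^ (Suc L - j) * (1 - q ^ j) * f (Suc L) c j)"
    by (rule sum.distrib)
  also have "(\<Sum>j\<le>Suc L. (1 - q ^ (Suc L - j)) * f (Suc L) c j) = (\<Sum>j\<le>L. f L c j)"
    using 1 by simp
  also have "(\<Sum>j\<le>Suc L. q ^ (Suc L - j) * (1 - q ^ j) * f (Suc L) c j)
           = q ^ (Suc L + c) * (\<Sum>j\<le>L. f L (Suc c) j)"
    unfolding sum_distrib_left using 2 by (subst sum.atMost_Suc_shift) simp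
  also have "(\<Sum>j\<le>L. f L c j) = 1 / (qpoch q q L * qpoch q q (L + c))"
    unfolding f_def by (rule Suc.IH)
  also have "(\<Sum>j\<le>L. f L (Suc c) j) = 1 / (qpoch q q L * qpoch q q (L + Suc c))"
    unfolding f_def by (rule Suc.IH)
  also have "1 / (qpoch q q L * qpoch q q (L + c))
           + q ^ (Suc L + c) * (1 / (qpoch q q L * qpoch q q (L + Suc c)))
           = (1 - q ^ Suc L) * (1 / (qpoch q q (Suc L) * qpoch q q (Suc L + c)))"
  proof -
    have "1 / (A * B) + Y * (1 / (A * (B * (1 - Y)))) = (1 - X) * (1 / (A * (1 - X) * (B * (1 - Y))))"
      if "A \<noteq> 0" "B \<noteq> 0" "1 - X \<noteq> 0" "1 - Y \<noteq> 0" for A B X Y :: complex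
      using that by (simp add: divide_simps)
    from this[OF nz[of L] nz[of "L + c"] one_minus_power_nonzero[OF q zero_less_Suc[of L]]
        one_minus_power_nonzero[OF q zero_less_Suc[of "L + c"]]]
    show ?thesis
      by (simp only: qpoch_Suc add_Suc add_Suc_right power_Suc mult.assoc)
  qed
  finally show ?case
    unfolding f_def
    by (rule mult_left_cancel[OF one_minus_power_nonzero[OF q zero_less_Suc], THEN iffD1])
qed simp

lemma Bailey_kernel:
  assumes q: "norm q < 1" and "r \<le> n"
  shows "(\<Sum>m=r..n. q ^ (m ^ 2 + m) / qpoch q q (n - m) / (qpoch q q (m - r) * qpoch q q (m + r + 1)))
       = q ^ (r ^ 2 + r) / (qpoch q q (n - r) * qpoch q q (n + r + 1))"
proof -
  define L where "L = n - r"
  have n: "n = L + r"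
    using assms by (simp add: L_def)
  have "(\<Sum>m=r..n. q ^ (m ^ 2 + m) / qpoch q q (n - m) / (qpoch q q (m - r) * qpoch q q (m + r + 1)))
      = (\<Sum>j\<le>L. q ^ (r ^ 2 + r) *
          (q ^ (j ^ 2 + (2 * r + 1) * j) /
            (qpoch q q (L - j) * qpoch q q j * qpoch q q (j + (2 * r + 1)))))"
  proof (rule sum.reindex_bij_witness[where i = "\<lambda>j. j + r" and j = "\<lambda>m. m - r"])
    fix m assume m: "m \<in> {r..n}"
    define j where "j = m - r"
    have mj: "m = j + r"
      using m by (simp add: j_def)
    have 1: "m ^ 2 + m = (r ^ 2 + r) + (j ^ 2 + (2 * r + 1) * j)"
      by (simp add: mj power2_eq_square algebra_simps)
    have 2: "m + r + 1 = j + (2 * r + 1)" "n - m = L - j"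
      by (simp_all add: mj n)
    show "q ^ (r ^ 2 + r) *
          (q ^ ((m - r) ^ 2 + (2 * r + 1) * (m - r)) /
            (qpoch q q (L - (m - r)) * qpoch q q (m - r) * qpoch q q (m - r + (2 * r + 1))))
      = q ^ (m ^ 2 + m) / qpoch q q (n - m) / (qpoch q q (m - r) * qpoch q q (m + r + 1))"
      unfolding 1 2 j_def[symmetric] by (simp add: power_add)
  qed (auto simp: n)
  also have "\<dots> = q ^ (r ^ 2 + r) * (1 / (qpoch q q L * qpoch q q (L + (2 * r + 1))))"
    unfolding sum_distrib_left[symmetric] q_Vandermonde[OF q] ..
  finally show ?thesis
    by (simp add: n add_ac mult_2)
qed

text \<open>Sequences with \<open>\<beta>\<^sub>n = \<Sum>\<^bsub>r\<le>n\<^esub> \<alpha>\<^sub>r / ((q)\<^bsub>n-r\<^esub> (q)\<^bsub>n+r+1\<^esub>)\<close> form a Bailey pair relative to \<open>q\<close>, up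
  to the factor \<open>1 - q\<close> that comes from writing \<open>(q)\<^bsub>n+r+1\<^esub>\<close> for \<open>(q\<^sup>2)\<^bsub>n+r\<^esub>\<close>. This is the Bailey lemma
  with both parameters sent to infinity: it replaces \<open>\<alpha>\<^sub>r\<close> by \<open>q\<^bsup>r\<^sup>2+r\<^esup> \<alpha>\<^sub>r\<close>.\<close>

lemma Bailey_step:
  fixes \<alpha> \<beta> :: "nat \<Rightarrow> complex"
  assumes q: "norm q < 1"
    and \<beta>: "\<And>n. \<beta> n = (\<Sum>r\<le>n. \<alpha> r / (qpoch q q (n - r) * qpoch q q (n + r + 1)))"
  shows "(\<Sum>m\<le>n. q ^ (m ^ 2 + m) / qpoch q q (n - m) * \<beta> m)
       = (\<Sum>r\<le>n. q ^ (r ^ 2 + r) * \<alpha> r / (qpoch q q (n - r) * qpoch q q (n + r + 1)))"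
proof -
  have "(\<Sum>m\<le>n. q ^ (m ^ 2 + m) / qpoch q q (n - m) * \<beta> m)
      = (\<Sum>m=0..n. \<Sum>r=0..m. \<alpha> r * (q ^ (m ^ 2 + m) / qpoch q q (n - m) /
          (qpoch q q (m - r) * qpoch q q (m + r + 1))))"
    unfolding \<beta> sum_distrib_left atMost_atLeast0
    by (intro sum.cong refl) simp
  also have "\<dots> = (\<Sum>r=0..n. \<Sum>m=r..n. \<alpha> r * (q ^ (m ^ 2 + m) / qpoch q q (n - m) /
          (qpoch q q (m - r) * qpoch q q (m + r + 1))))"
    unfolding sum.Sigma[OF finite_atLeastAtMost ballI[OF finite_atLeastAtMost]]
    by (rule sum.reindex_bij_witness[where i = "\<lambda>(r, m). (m, r)" and j = "\<lambda>(m, r). (r, m)"]) auto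
  also have "\<dots> = (\<Sum>r=0..n. \<alpha> r * (q ^ (r ^ 2 + r) / (qpoch q q (n - r) * qpoch q q (n + r + 1))))"
    unfolding sum_distrib_left[symmetric] by (intro sum.cong refl arg_cong2[where f = "(*)"] Bailey_kernel q) auto
  finally show ?thesis
    by (simp add: atMost_atLeast0 mult.commute)
qed

section \<open>The initial Bailey pair\<close>

text \<open>The \<open>\<alpha>\<close>-side of the pair whose \<open>\<beta>\<close>-side is the innermost sum, over \<open>n\<^sub>k\<close> and \<open>n\<^bsub>k+1\<^esub>\<close> with fixed
  sum. The factor \<open>2 r + 1\<close> of the theta series originates here.\<close>

definition seed_alpha :: "complex \<Rightarrow> nat \<Rightarrow> complex" where
  "seed_alpha q r = of_nat (2 * r + 1) * q ^ (r ^ 2) * (1 - q ^ (2 * r + 1))"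

text \<open>Put \<open>T\<^sub>r = q\<^bsup>r\<^sup>2\<^esup> / ((q)\<^bsub>n-r\<^esub> (q)\<^bsub>n+r\<^esub>)\<close>, which is 0 for \<open>r > n\<close>. The left-hand side is the sum of
  \<open>T\<^bsub>\<bar>r\<bar>\<^esub>\<close> over all integers \<open>r\<close>, where \<open>r = a - n\<close>. Each summand on the right equals
  \<open>(2 r + 1) (T\<^sub>r - T\<^bsub>r+1\<^esub>)\<close>, so summation by parts gives the same value.\<close>

lemma seed_Bailey_pair:
  assumes q: "norm q < 1"
  shows "(\<Sum>a\<le>2 * n. q ^ (nat \<bar>int a - int n\<bar> ^ 2) / (qpoch q q a * qpoch q q (2 * n - a)))
       = (\<Sum>r\<le>n. seed_alpha q r / (qpoch q q (n - r) * qpoch q q (n + r + 1)))"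
proof -
  note nz = qpoch_nonzero[OF q]
  define T where "T r = (if r \<le> n then q ^ (r ^ 2) / (qpoch q q (n - r) * qpoch q q (n + r)) else 0)" for r
  define g where "g a = q ^ (nat \<bar>int a - int n\<bar> ^ 2) / (qpoch q q a * qpoch q q (2 * n - a))" for a
  have lower: "g (n - r) = T r" and upper: "g (n + r) = T r" if "r \<le> n" for r
  proof -
    have "nat \<bar>int (n - r) - int n\<bar> = r" "2 * n - (n - r) = n + r"
      using that by auto
    then show "g (n - r) = T r"
      using that by (simp only: g_def T_def if_True)
    have "nat \<bar>int (n + r) - int n\<bar> = r" "2 * n - (n + r) = n - r"
      using that by auto
    then show "g (n + r) = T r"
      using that by (simp only: g_def T_def if_True mult.commute)
  qed
  have "(\<Sum>a\<le>2 * n. g a) = (\<Sum>a\<in>{..<n} \<union> {n..2*n}. g a)"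
    by (rule sum.cong) auto
  also have "\<dots> = (\<Sum>a<n. g a) + (\<Sum>a=n..2*n. g a)"
    by (rule sum.union_disjoint) auto
  also have "(\<Sum>a<n. g a) = (\<Sum>r=1..n. T r)"
    by (rule sum.reindex_bij_witness[where i = "\<lambda>r. n - r" and j = "\<lambda>a. n - a"])
       (auto simp: lower[symmetric])
  also have "(\<Sum>a=n..2*n. g a) = (\<Sum>r\<le>n. T r)"
    by (rule sum.reindex_bij_witness[where i = "\<lambda>r. n + r" and j = "\<lambda>a. a - n"])
       (auto simp: upper[symmetric])
  finally have 1: "(\<Sum>a\<le>2 * n. g a) = (\<Sum>r=1..n. T r) + (\<Sum>r\<le>n. T r)" .
  have 2: "seed_alpha q r / (qpoch q q (n - r) * qpoch q q (n + r + 1))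
        = of_nat (2 * r + 1) * (T r - T (Suc r))" if "r \<le> n" for r
  proof (cases "r = n")
    case True
    have "1 - q ^ (2 * n + 1) \<noteq> 0"
      by (rule one_minus_power_nonzero[OF q]) simp
    moreover have "qpoch q q (n + n + 1) = qpoch q q (n + n) * (1 - q ^ (2 * n + 1))"
      by (simp add: qpoch_Suc mult_2)
    ultimately show ?thesis
      by (simp add: T_def True seed_alpha_def)
  next
    case False
    define d where "d = n - Suc r"
    have n: "n = Suc r + d"
      using False that by (simp add: d_def)
    have 3: "qpoch q q (n + r + 1) = qpoch q q (n + r) * (1 - q ^ (n + r + 1))"
      by (simp add: qpoch_Suc)
    have 4: "qpoch q q (n - r) = qpoch q q d * (1 - q ^ (Suc d))"
      by (simp add: n qpoch_Suc)
    have nz': "1 - q ^ (n + r + 1) \<noteq> 0" "1 - q ^ Suc d \<noteq> 0"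
      by (rule one_minus_power_nonzero[OF q]; simp)+
    have Tr: "T r = q ^ (r ^ 2) / (qpoch q q (n - r) * qpoch q q (n + r))"
      using that by (simp add: T_def)
    have "T (Suc r) = q ^ (Suc r ^ 2) / (qpoch q q d * qpoch q q (n + r + 1))"
      by (simp add: T_def n)
    also have "Suc r ^ 2 = r ^ 2 + (2 * r + 1)"
      by (simp add: power2_eq_square)
    finally have TSr: "T (Suc r) = q ^ (r ^ 2) * q ^ (2 * r + 1) / (qpoch q q d * qpoch q q (n + r + 1))"
      by (simp only: power_add)
    have X: "q ^ (n + r + 1) = q ^ (2 * r + 1) * q ^ Suc d"
      unfolding power_add[symmetric] by (simp add: n mult_2 add_ac)
    have "c * a * (1 - X) / ((A * (1 - Z)) * (B * (1 - X * Z)))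
        = c * (a / ((A * (1 - Z)) * B) - a * X / (A * (B * (1 - X * Z))))"
      if "A \<noteq> 0" "B \<noteq> 0" "1 - X * Z \<noteq> 0" "1 - Z \<noteq> 0" for a c A B X Z :: complex
      using that by (simp add: divide_simps) (simp add: algebra_simps)
    from this[OF nz[of d] nz[of "n + r"] nz'[unfolded X]]
    show ?thesis
      unfolding Tr TSr 3 4 X seed_alpha_def .
  qed
  have "(\<Sum>r\<le>N. of_nat (2 * r + 1) * (T r - T (Suc r)))
      = (\<Sum>r=1..N. T r) + (\<Sum>r\<le>N. T r) - of_nat (2 * N + 1) * T (Suc N)" for N
    by (induction N) (simp_all add: algebra_simps)
  from this[of n] have "(\<Sum>r\<le>n. of_nat (2 * r + 1) * (T r - T (Suc r)))
      = (\<Sum>r=1..n. T r) + (\<Sum>r\<le>n. T r)"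
    by (simp add: T_def[of "Suc n"])
  with 1 2 show ?thesis
    by (simp add: g_def)
qed

section \<open>A limiting case of the q-Gauss sum\<close>

lemma triangle_ge: "n \<le> triangle n"
  by (induction n) auto

lemma triangle_add: "triangle (r + j) = triangle r + triangle j + r * j"
  by (induction j) auto

text \<open>For \<open>N = r + j\<close>, the quotient \<open>(-q)\<^sub>N q\<^bsup>N(N+1)/2\<^esup> / ((q)\<^bsub>N-r\<^esub> (q)\<^bsub>N+r+1\<^esub>)\<close> divided by \<open>q\<^bsup>r(r+1)/2\<^esup>\<close>. The
  exponent \<open>N (N + 1) / 2\<close> is written as \<^term>\<open>triangle N\<close>.\<close>

definition Gauss_term :: "complex \<Rightarrow> nat \<Rightarrow> nat \<Rightarrow> complex" where
  "Gauss_term q r j = qpoch (- q) q (r + j) * q ^ (r * j + triangle j) /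
     (qpoch q q j * qpoch q q (2 * r + 1 + j))"

lemma norm_Gauss_term_le:
  assumes q: "norm q < 1"
  obtains C where "\<And>r j. norm (Gauss_term q r j) \<le> C * norm q ^ j"
proof -
  obtain C where C: "C > 0" "\<And>n. norm (qpoch (- q) q n) \<le> C" "\<And>n. norm (1 / qpoch q q n) \<le> C"
    using qpoch_bounds[OF q] by blast
  have "norm (Gauss_term q r j) \<le> C * C * C * norm q ^ j" for r j
  proof -
    have "Gauss_term q r j = qpoch (- q) q (r + j) * (1 / qpoch q q j) *
        (1 / qpoch q q (2 * r + 1 + j)) * q ^ (r * j + triangle j)"
      by (simp add: Gauss_term_def)
    also have "norm \<dots> = norm (qpoch (- q) q (r + j)) * norm (1 / qpoch q q j) *
        norm (1 / qpoch q q (2 * r + 1 + j)) * norm q ^ (r * j + triangle j)"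
      by (simp only: norm_mult norm_power)
    also have "\<dots> \<le> C * C * C * norm q ^ j"
      using C(1) q triangle_ge[of j]
      by (intro mult_mono C mult_nonneg_nonneg power_decreasing) auto
    finally show ?thesis .
  qed
  then show ?thesis
    by (rule that)
qed

lemma Gauss_term_summable:
  assumes q: "norm q < 1"
  shows "summable (Gauss_term q r)"
proof -
  obtain C where C: "\<And>r j. norm (Gauss_term q r j) \<le> C * norm q ^ j"
    using norm_Gauss_term_le[OF q] by blast
  show ?thesis
    by (rule summable_comparison_test'[of "\<lambda>j. C * norm q ^ j" 0])
       (use q C in \<open>auto intro!: summable_mult summable_geometric\<close>)
qed

text \<open>The difference of the summands for \<open>r + 1\<close> and \<open>r\<close>, the latter shifted by one, telescopes
  against the certificate \<open>h\<close> below, as in the method of Wilf and Zeilberger.\<close>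

lemma suminf_Gauss_term_Suc:
  assumes q: "norm q < 1"
  shows "(\<Sum>j. Gauss_term q (Suc r) j) = (\<Sum>j. Gauss_term q r j)"
proof -
  note nz = qpoch_nonzero[OF q]
  define h where "h j = - (1 - q ^ Suc r) * (qpoch (- q) q (Suc r + j) * q ^ (triangle j + Suc r * j) /
      (qpoch q q j * qpoch q q (2 * r + 2 + j)))" for j
  have step: "Gauss_term q (Suc r) j - Gauss_term q r (Suc j) = h (Suc j) - h j" for j
  proof -
    define x where "x = q ^ j"
    define y where "y = q ^ r"
    define P where "P = qpoch (- q) q (Suc r + j)"
    define D where "D = qpoch q q j"
    define E where "E = qpoch q q (2 * r + 2 + j)"
    define Q where "Q = q ^ (r * j + triangle j)"
    have [simp]: "qpoch q q (Suc j) = D * (1 - q * x)"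
      by (simp add: D_def x_def qpoch_Suc)
    have [simp]: "qpoch (- q) q (Suc (Suc (r + j))) = P * (1 + q * q * x * y)"
      by (simp add: P_def x_def y_def qpoch_Suc power_add mult_ac)
    have [simp]: "qpoch q q (Suc (Suc (Suc (2 * r + j)))) = E * (1 - q ^ 3 * y ^ 2 * x)"
      by (simp add: E_def x_def y_def qpoch_Suc power_add power_mult power2_eq_square power3_eq_cube
            mult_2 mult_ac)
    have 1: "Gauss_term q (Suc r) j = P * (Q * x) / (D * (E * (1 - q ^ 3 * y ^ 2 * x)))"
      by (simp add: Gauss_term_def P_def[symmetric] D_def[symmetric] E_def)
         (simp add: P_def E_def D_def Q_def x_def power_add mult_ac)
    have 2: "Gauss_term q r (Suc j) = P * (Q * (y * q * x)) / (D * (1 - q * x) * E)"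
      by (simp add: Gauss_term_def)
         (simp add: P_def E_def D_def Q_def x_def y_def power_add mult_ac)
    have 3: "h j = - (1 - q * y) * (P * (Q * x) / (D * E))"
      by (simp add: h_def P_def E_def D_def Q_def x_def y_def power_add mult_ac)
    have 4: "h (Suc j) = - (1 - q * y) * (P * (1 + q * q * x * y) * (Q * x * (q * x) * (q * y)) /
               (D * (1 - q * x) * (E * (1 - q ^ 3 * y ^ 2 * x))))"
      by (simp add: h_def)
         (simp add: P_def E_def D_def Q_def x_def y_def power_add mult_ac)
    have nz': "1 - q * x \<noteq> 0" "1 - q ^ 3 * y ^ 2 * x \<noteq> 0"
    proof -
      show "1 - q * x \<noteq> 0"
        using one_minus_power_nonzero[OF q, of "Suc j"] by (simp add: x_def)
      have "q ^ 3 * y ^ 2 * x = q ^ (3 + r * 2 + j)"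
        by (simp add: y_def x_def power_add power_mult)
      then show "1 - q ^ 3 * y ^ 2 * x \<noteq> 0"
        using one_minus_power_nonzero[OF q, of "3 + r * 2 + j"] by simp
    qed
    have nz'': "D \<noteq> 0" "E \<noteq> 0"
      by (simp_all add: D_def E_def nz)
    \<comment> \<open>With \<open>x = q\<^bsup>j\<^esup>\<close> and \<open>y = q\<^bsup>r\<^esup>\<close> the claim becomes an identity of rational functions.\<close>
    let ?R = "D * E * (1 - q * x) * (1 - q ^ 3 * y ^ 2 * x)"
    have "Gauss_term q (Suc r) j - Gauss_term q r (Suc j)
        = P * Q * x * ((1 - q * x) - y * q * (1 - q ^ 3 * y ^ 2 * x)) / ?R"
      unfolding 1 2 using nz' nz'' by (simp add: divide_simps) (simp add: algebra_simps)
    also have "(1 - q * x) - y * q * (1 - q ^ 3 * y ^ 2 * x)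
        = (1 - q * y) * ((1 - q * x) * (1 - q ^ 3 * y ^ 2 * x) - (1 + q * q * x * y) * (q * x * (q * y)))"
      by (simp add: algebra_simps power2_eq_square power3_eq_cube)
    also have "P * Q * x * \<dots> / ?R = h (Suc j) - h j"
      unfolding 3 4 using nz' nz'' by (simp add: divide_simps) (simp add: algebra_simps)
    finally show ?thesis .
  qed
  have h0: "h 0 = - Gauss_term q r 0"
  proof -
    have "1 - q ^ (2 * Suc r) \<noteq> 0"
      by (rule one_minus_power_nonzero[OF q]) simp
    then have "1 - q * (q * q ^ (2 * r)) \<noteq> 0" by simp
    moreover have "q * (q * q ^ (2 * r)) = (q * q ^ r) ^ 2"
      by (simp add: power2_eq_square mult_2 power_add)
    ultimately show ?thesis
      using nz[of "Suc (2 * r)"] unfolding h_def Gauss_term_def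
      by (simp add: qpoch_Suc[of _ _ r] qpoch_Suc[of _ _ "Suc (2 * r)"] divide_simps)
         (simp add: algebra_simps power2_eq_square)
  qed
  have "h \<longlonglongrightarrow> 0"
  proof -
    obtain C where C: "C > 0" "\<And>n. norm (qpoch (- q) q n) \<le> C" "\<And>n. norm (1 / qpoch q q n) \<le> C"
      using qpoch_bounds[OF q] by blast
    have "norm (h j) \<le> norm (1 - q ^ Suc r) * (C * C * C) * norm q ^ j" for j
    proof -
      have "norm (h j) = norm (1 - q ^ Suc r) * (norm (qpoch (- q) q (Suc r + j)) * norm (1 / qpoch q q j) *
          norm (1 / qpoch q q (2 * r + 2 + j))) * norm q ^ (triangle j + Suc r * j)"
        by (simp add: h_def norm_mult norm_power norm_divide norm_minus_commute)
      also have "\<dots> \<le> norm (1 - q ^ Suc r) * (C * C * C) * norm q ^ j"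
        using C(1) q triangle_ge[of j]
        by (intro mult_mono C mult_nonneg_nonneg power_decreasing) auto
      finally show ?thesis .
    qed
    moreover have "(\<lambda>j. norm (1 - q ^ Suc r) * (C * C * C) * norm q ^ j) \<longlonglongrightarrow> 0"
      using q by (intro tendsto_mult_right_zero LIMSEQ_power_zero) simp
    ultimately show ?thesis
      by (rule Lim_null_comparison[OF always_eventually[OF allI]])
  qed
  then have "(\<lambda>j. h (Suc j) - h j) sums (0 - h 0)"
    by (rule telescope_sums)
  moreover have "(\<lambda>j. Gauss_term q (Suc r) j - Gauss_term q r (Suc j)) sums
      ((\<Sum>j. Gauss_term q (Suc r) j) - (\<Sum>j. Gauss_term q r (Suc j)))"
    using Gauss_term_summable[OF q]
    by (intro sums_diff summable_sums) (simp_all only: summable_Suc_iff)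
  ultimately have "(\<Sum>j. Gauss_term q (Suc r) j) - (\<Sum>j. Gauss_term q r (Suc j)) = Gauss_term q r 0"
    unfolding step using h0 sums_unique2 by fastforce
  moreover have "(\<Sum>j. Gauss_term q r (Suc j)) = (\<Sum>j. Gauss_term q r j) - Gauss_term q r 0"
    by (rule suminf_split_head[OF Gauss_term_summable[OF q]])
  ultimately show ?thesis
    by simp
qed

text \<open>The case of the q-Gauss sum with one parameter sent to infinity. The value does not depend on
  \<open>r\<close>, and for \<open>r \<rightarrow> \<infinity>\<close> only the summand \<open>j = 0\<close> survives, by Tannery's theorem.\<close>

lemma Gauss_term_sums:
  assumes q: "norm q < 1"
  shows "Gauss_term q r sums (qpoch_inf (- q) q / qpoch_inf q q)"
proof -
  let ?P = "qpoch_inf (- q) q / qpoch_inf q q"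
  obtain C where C: "\<And>r j. norm (Gauss_term q r j) \<le> C * norm q ^ j"
    using norm_Gauss_term_le[OF q] by blast
  have const: "(\<Sum>j. Gauss_term q r j) = (\<Sum>j. Gauss_term q 0 j)" for r
    by (induction r) (simp_all add: suminf_Gauss_term_Suc[OF q])
  have lim: "(\<lambda>r. Gauss_term q r j) \<longlonglongrightarrow> (if j = 0 then ?P else 0)" for j
  proof -
    have 1: "(\<lambda>r. qpoch (- q) q (r + j)) \<longlonglongrightarrow> qpoch_inf (- q) q"
      by (rule LIMSEQ_ignore_initial_segment[OF qpoch_LIMSEQ[OF q]])
    have "(\<lambda>r. qpoch q q (2 * r + (1 + j))) \<longlonglongrightarrow> qpoch_inf q q"
      using LIMSEQ_subseq_LIMSEQ[OF qpoch_LIMSEQ[OF q, of q], of "\<lambda>r. 2 * r + (1 + j)"]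
      by (simp add: strict_mono_def o_def)
    then have 2: "(\<lambda>r. qpoch q q j * qpoch q q (2 * r + 1 + j)) \<longlonglongrightarrow> qpoch q q j * qpoch_inf q q"
      by (intro tendsto_mult tendsto_const) (simp add: add.assoc)
    have 3: "(\<lambda>r. q ^ (r * j + triangle j)) \<longlonglongrightarrow> (if j = 0 then 1 else 0)"
    proof (cases "j = 0")
      case False
      then have "norm (q ^ j) < 1"
        using q by (simp add: norm_power power_less_one_iff)
      then have "(\<lambda>r. (q ^ j) ^ r * q ^ triangle j) \<longlonglongrightarrow> 0"
        by (intro tendsto_mult_left_zero LIMSEQ_power_zero)
      then show ?thesis
        using False by (simp add: power_add power_mult[symmetric] mult.commute)
    qed simp
    have "(\<lambda>r. Gauss_term q r j) \<longlonglongrightarrow>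
        qpoch_inf (- q) q * (if j = 0 then 1 else 0) / (qpoch q q j * qpoch_inf q q)"
      unfolding Gauss_term_def
      by (intro tendsto_divide tendsto_mult 1 2[unfolded add.assoc] 3)
         (use qpoch_nonzero[OF q] qpoch_inf_nonzero[OF q] 2 in auto)
    then show ?thesis
      by (cases "j = 0") auto
  qed
  have "(\<lambda>r. \<Sum>j. Gauss_term q r j) \<longlonglongrightarrow> (\<Sum>j. if j = 0 then ?P else 0)"
  proof (rule tannerys_theorem[THEN conjunct2, THEN conjunct2])
    show "(\<lambda>r. Gauss_term q r j) \<longlonglongrightarrow> (if j = 0 then ?P else 0)" for j
      by (rule lim)
    show "\<forall>\<^sub>F (j, r) in sequentially \<times>\<^sub>F sequentially. norm (Gauss_term q r j) \<le> C * norm q ^ j"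
      by (rule always_eventually) (use C in auto)
    show "summable (\<lambda>j. C * norm q ^ j)"
      using q by (intro summable_mult summable_geometric) simp
  qed simp
  moreover have "(\<Sum>j. if j = 0 then ?P else 0) = ?P"
    using suminf_finite[of "{0::nat}" "\<lambda>j. if j = 0 then ?P else 0"] by simp
  moreover have "(\<lambda>r. \<Sum>j. Gauss_term q r j) = (\<lambda>r. \<Sum>j. Gauss_term q 0 j)"
    by (rule ext) (rule const)
  ultimately have "(\<lambda>r::nat. \<Sum>j. Gauss_term q 0 j) \<longlonglongrightarrow> ?P"
    by metis
  then have "(\<Sum>j. Gauss_term q r j) = ?P"
    unfolding const[of r] by (simp add: LIMSEQ_const_iff)
  then show ?thesis
    using summable_sums[OF Gauss_term_summable[OF q, of r]] by simp
qed

section \<open>Nested sums over index vectors\<close>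

text \<open>The partial sums \<open>N\<^sub>i = n\<^sub>i + \<cdots> + n\<^bsub>k-1\<^esub> + (n\<^sub>k + n\<^bsub>k+1\<^esub>) / 2\<close>, for \<open>i \<le> k\<close>. The last two entries
  are always taken to have the same parity, which makes the division exact.\<close>

definition partial_total :: "nat \<Rightarrow> nat \<Rightarrow> (nat \<Rightarrow> nat) \<Rightarrow> nat" where
  "partial_total k i n = (\<Sum>j=i..<k. n j) + (n k + n (k + 1)) div 2"

text \<open>The tails \<open>(n\<^sub>i, \<dots>, n\<^bsub>k+1\<^esub>)\<close> of index vectors with prescribed \<open>N\<^sub>i = N\<close>. Keeping the original
  positions of the entries avoids shifting indices when \<open>n\<^sub>i\<close> is split off.\<close>

definition tail_vectors :: "nat \<Rightarrow> nat \<Rightarrow> nat \<Rightarrow> (nat \<Rightarrow> nat) set" where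
  "tail_vectors k i N =
     {n \<in> {i..k+1} \<rightarrow>\<^sub>E UNIV. [n k = n (k + 1)] (mod 2) \<and> partial_total k i n = N}"

text \<open>The number \<open>\<bar>n\<^sub>k - n\<^bsub>k+1\<^esub>\<bar> / 2\<close>, expressed as \<open>\<bar>n\<^sub>k - N\<^sub>k\<bar>\<close> so that it is a natural number.\<close>

definition half_difference :: "nat \<Rightarrow> (nat \<Rightarrow> nat) \<Rightarrow> nat" where
  "half_difference k n = nat \<bar>int (n k) - int (partial_total k k n)\<bar>"

text \<open>The factor that a tail contributes to the summand once \<open>N\<^sub>i\<close> is fixed; the factors
  \<open>q\<^bsup>N\<^sub>j\<^sup>2+N\<^sub>j\<^esup>\<close> occur for \<open>j > i\<close> only, because the one for \<open>j = i\<close> belongs to the step that splits off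
  \<open>n\<^bsub>i-1\<^esub>\<close> if \<open>i \<ge> 2\<close>, and \<open>N\<^sub>1\<close> enters through \<open>q\<^bsup>N(N+1)/2\<^esup> (-q)\<^sub>N\<close> instead.\<close>

definition tail_weight :: "complex \<Rightarrow> nat \<Rightarrow> nat \<Rightarrow> (nat \<Rightarrow> nat) \<Rightarrow> complex" where
  "tail_weight q k i n =
     q ^ ((\<Sum>j=Suc i..k. partial_total k j n ^ 2 + partial_total k j n) + half_difference k n ^ 2)
     / (\<Prod>j=i..k+1. qpoch q q (n j))"

lemma cong_2_iff_even_add: "[a = b] (mod 2) \<longleftrightarrow> even (a + b)" for a b :: nat
  unfolding cong_def by presburger

lemma partial_total_Suc:
  assumes "i < k"
  shows "partial_total k i n = n i + partial_total k (Suc i) n"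
  using assms by (simp add: partial_total_def sum.atLeast_Suc_lessThan)

lemma partial_total_cong:
  assumes "\<And>j. i \<le> j \<Longrightarrow> j \<le> k + 1 \<Longrightarrow> n j = n' j" "i \<le> k"
  shows "partial_total k i n = partial_total k i n'"
proof -
  have "(\<Sum>j=i..<k. n j) = (\<Sum>j=i..<k. n' j)"
    using assms by (intro sum.cong) auto
  then show ?thesis
    using assms by (simp add: partial_total_def)
qed

lemma half_difference_cong:
  assumes "n k = n' k" "n (k + 1) = n' (k + 1)"
  shows "half_difference k n = half_difference k n'"
  using assms by (simp add: half_difference_def partial_total_def)

lemma component_le_partial_total:
  assumes "j \<in> {i..k+1}"
  shows "n j \<le> 2 * partial_total k i n + 1"
proof (cases "j < k")
  case True
  then have "n j \<le> (\<Sum>j=i..<k. n j)"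
    using assms by (intro member_le_sum) auto
  then show ?thesis
    by (simp add: partial_total_def)
next
  case False
  then have "j = k \<or> j = k + 1"
    using assms by auto
  then show ?thesis
    by (auto simp: partial_total_def)
qed

lemma finite_tail_vectors: "finite (tail_vectors k i N)"
proof (rule finite_subset)
  show "tail_vectors k i N \<subseteq> {i..k+1} \<rightarrow>\<^sub>E {..2 * N + 1}"
  proof
    fix n assume n: "n \<in> tail_vectors k i N"
    have "n j \<le> 2 * N + 1" if "j \<in> {i..k+1}" for j
      using component_le_partial_total[OF that, of n] n by (simp add: tail_vectors_def)
    then show "n \<in> {i..k+1} \<rightarrow>\<^sub>E {..2 * N + 1}"
      using n by (auto simp: tail_vectors_def PiE_iff)
  qed
qed (intro finite_PiE finite_atLeastAtMost finite_atMost)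

text \<open>Splitting off \<open>n\<^sub>i = N - m\<close>, where \<open>m = N\<^bsub>i+1\<^esub>\<close>: this is exactly the left-hand side of
  the Bailey step.\<close>

lemma tail_sum_recursion:
  assumes "i < k"
  shows "(\<Sum>n\<in>tail_vectors k i N. tail_weight q k i n)
       = (\<Sum>m\<le>N. q ^ (m ^ 2 + m) / qpoch q q (N - m) *
            (\<Sum>n\<in>tail_vectors k (Suc i) m. tail_weight q k (Suc i) n))"
proof -
  define ext where "ext m n = n(i := N - m)" for m and n :: "nat \<Rightarrow> nat"
  have pt: "partial_total k j (ext m n) = partial_total k j n" if "i < j" "j \<le> k" for j m n
    by (rule partial_total_cong) (use that in \<open>auto simp: ext_def\<close>)
  have hd: "half_difference k (ext m n) = half_difference k n" for m n
    by (rule half_difference_cong) (use assms in \<open>auto simp: ext_def\<close>)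
  have mem: "ext m n \<in> tail_vectors k i N"
    if "m \<le> N" and n: "n \<in> tail_vectors k (Suc i) m" for m n
  proof -
    have "ext m n \<in> {i..k+1} \<rightarrow>\<^sub>E UNIV"
      using n assms by (auto simp: ext_def tail_vectors_def PiE_iff extensional_def)
    moreover have "partial_total k i (ext m n) = N"
      using that n assms pt[of "Suc i"]
      by (subst partial_total_Suc) (auto simp: tail_vectors_def ext_def)
    moreover have "[ext m n k = ext m n (k + 1)] (mod 2)"
      using n assms by (simp add: ext_def tail_vectors_def)
    ultimately show ?thesis
      by (simp add: tail_vectors_def)
  qed
  have weight: "tail_weight q k i (ext m n)
      = q ^ (m ^ 2 + m) / qpoch q q (N - m) * tail_weight q k (Suc i) n"
    if n: "n \<in> tail_vectors k (Suc i) m" for m n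
  proof -
    have "(\<Sum>j=Suc i..k. partial_total k j (ext m n) ^ 2 + partial_total k j (ext m n))
        = (\<Sum>j=Suc i..k. partial_total k j n ^ 2 + partial_total k j n)"
      by (rule sum.cong) (auto simp: pt)
    also have "\<dots> = (m ^ 2 + m) + (\<Sum>j=Suc (Suc i)..k. partial_total k j n ^ 2 + partial_total k j n)"
      using n assms by (subst sum.atLeast_Suc_atMost) (auto simp: tail_vectors_def)
    finally have 1: "(\<Sum>j=Suc i..k. partial_total k j (ext m n) ^ 2 + partial_total k j (ext m n))
        = (m ^ 2 + m) + (\<Sum>j=Suc (Suc i)..k. partial_total k j n ^ 2 + partial_total k j n)" .
    have "(\<Prod>j=i..k+1. qpoch q q (ext m n j))
        = qpoch q q (ext m n i) * (\<Prod>j=Suc i..k+1. qpoch q q (ext m n j))"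
      using assms by (subst prod.atLeast_Suc_atMost) auto
    also have "(\<Prod>j=Suc i..k+1. qpoch q q (ext m n j)) = (\<Prod>j=Suc i..k+1. qpoch q q (n j))"
      by (rule prod.cong) (auto simp: ext_def)
    also have "ext m n i = N - m"
      by (simp add: ext_def)
    finally have 2: "(\<Prod>j=i..k+1. qpoch q q (ext m n j))
        = qpoch q q (N - m) * (\<Prod>j=Suc i..k+1. qpoch q q (n j))" .
    show ?thesis
      unfolding tail_weight_def 1 2 hd by (simp add: power_add)
  qed
  have "(\<Sum>m\<le>N. q ^ (m ^ 2 + m) / qpoch q q (N - m) *
            (\<Sum>n\<in>tail_vectors k (Suc i) m. tail_weight q k (Suc i) n))
      = (\<Sum>(m, n)\<in>Sigma {..N} (tail_vectors k (Suc i)).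
            q ^ (m ^ 2 + m) / qpoch q q (N - m) * tail_weight q k (Suc i) n)"
    unfolding sum_distrib_left by (rule sum.Sigma) (auto simp: finite_tail_vectors)
  also have "\<dots> = (\<Sum>n\<in>tail_vectors k i N. tail_weight q k i n)"
  proof (rule sum.reindex_bij_witness[where j = "\<lambda>(m, n). ext m n"
        and i = "\<lambda>n. (partial_total k (Suc i) n, restrict n {Suc i..k+1})"])
    fix n assume n: "n \<in> tail_vectors k i N"
    then have N: "N = n i + partial_total k (Suc i) n"
      using partial_total_Suc[OF assms] by (auto simp: tail_vectors_def)
    have pt': "partial_total k (Suc i) (restrict n {Suc i..k+1}) = partial_total k (Suc i) n"
      by (rule partial_total_cong) (use assms in auto)
    show "(case (partial_total k (Suc i) n, restrict n {Suc i..k+1}) of (m, n) \<Rightarrow> ext m n) = n"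
    proof
      fix j
      show "(case (partial_total k (Suc i) n, restrict n {Suc i..k+1}) of (m, n) \<Rightarrow> ext m n) j = n j"
        using n N by (auto simp: ext_def tail_vectors_def PiE_iff extensional_def restrict_def)
    qed
    show "(partial_total k (Suc i) n, restrict n {Suc i..k+1}) \<in> Sigma {..N} (tail_vectors k (Suc i))"
      using n N assms pt' by (auto simp: tail_vectors_def)
  next
    fix p assume p: "p \<in> Sigma {..N} (tail_vectors k (Suc i))"
    obtain m n where mn: "p = (m, n)" "m \<le> N" "n \<in> tail_vectors k (Suc i) m"
      using p by auto
    have "partial_total k (Suc i) (ext m n) = m"
      using mn pt[of "Suc i"] assms by (simp add: tail_vectors_def)
    moreover have "restrict (ext m n) {Suc i..k+1} = n"
      using mn by (auto simp: ext_def tail_vectors_def PiE_iff extensional_def restrict_def fun_eq_iff)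
    ultimately show "(partial_total k (Suc i) (case p of (m, n) \<Rightarrow> ext m n),
        restrict (case p of (m, n) \<Rightarrow> ext m n) {Suc i..k+1}) = p"
      using mn by simp
    show "(case p of (m, n) \<Rightarrow> ext m n) \<in> tail_vectors k i N"
      using mn mem by simp
    show "tail_weight q k i (case p of (m, n) \<Rightarrow> ext m n) =
        (case p of (m, n) \<Rightarrow> q ^ (m ^ 2 + m) / qpoch q q (N - m) * tail_weight q k (Suc i) n)"
      using mn weight by simp
  qed
  finally show ?thesis ..
qed

lemma tail_sum_base:
  "(\<Sum>n\<in>tail_vectors k k N. tail_weight q k k n)
   = (\<Sum>a\<le>2 * N. q ^ (nat \<bar>int a - int N\<bar> ^ 2) / (qpoch q q a * qpoch q q (2 * N - a)))"
proof (rule sum.reindex_bij_witness[where j = "\<lambda>n. n k"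
      and i = "\<lambda>a. restrict (\<lambda>j. if j = k then a else 2 * N - a) {k..k+1}"])
  fix n assume n: "n \<in> tail_vectors k k N"
  have "even (n k + n (k + 1))"
    using n by (simp add: tail_vectors_def cong_2_iff_even_add)
  moreover have "(n k + n (k + 1)) div 2 = N"
    using n by (simp add: tail_vectors_def partial_total_def)
  ultimately have total: "n k + n (k + 1) = 2 * N"
    by auto
  show "restrict (\<lambda>j. if j = k then n k else 2 * N - n k) {k..k+1} = n"
  proof
    fix j
    show "restrict (\<lambda>j. if j = k then n k else 2 * N - n k) {k..k+1} j = n j"
    proof (cases "j \<in> {k..k+1}")
      case True
      then have "j = k \<or> j = k + 1" by auto
      then show ?thesis
        using total by auto
    next
      case False
      then show ?thesis
        using n by (auto simp: tail_vectors_def PiE_iff extensional_def)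
    qed
  qed
  show "n k \<in> {..2 * N}"
    using total by simp
  have "n (k + 1) = 2 * N - n k"
    using total by simp
  moreover have "{k..k+1} = {k, k + 1}"
    by auto
  moreover have "partial_total k k n = N"
    using n by (simp add: tail_vectors_def)
  ultimately show "q ^ (nat \<bar>int (n k) - int N\<bar> ^ 2) / (qpoch q q (n k) * qpoch q q (2 * N - n k)) =
      tail_weight q k k n"
    by (simp add: tail_weight_def half_difference_def)
next
  fix a assume a: "a \<in> {..2 * N}"
  have "[a = 2 * N - a] (mod 2)"
    using a by (simp add: cong_2_iff_even_add)
  then show "restrict (\<lambda>j. if j = k then a else 2 * N - a) {k..k+1} \<in> tail_vectors k k N"
    using a by (auto simp: tail_vectors_def partial_total_def)
qed simp

text \<open>Hence \<open>d\<close> Bailey steps applied to the initial pair evaluate the sum over the tails that begin at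
  position \<open>k - d\<close>.\<close>

lemma tail_sum_eq:
  assumes q: "norm q < 1" and "d \<le> k"
  shows "(\<Sum>n\<in>tail_vectors k (k - d) N. tail_weight q k (k - d) n)
       = (\<Sum>r\<le>N. (q ^ (r ^ 2 + r)) ^ d * seed_alpha q r / (qpoch q q (N - r) * qpoch q q (N + r + 1)))"
  using \<open>d \<le> k\<close>
proof (induction d arbitrary: N)
  case 0
  then show ?case
    by (simp add: tail_sum_base seed_Bailey_pair[OF q, unfolded Suc_eq_plus1[symmetric]])
next
  case (Suc d)
  have "Suc (k - Suc d) = k - d"
    using Suc.prems by simp
  then have "(\<Sum>n\<in>tail_vectors k (k - Suc d) N. tail_weight q k (k - Suc d) n)
      = (\<Sum>m\<le>N. q ^ (m ^ 2 + m) / qpoch q q (N - m) *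
            (\<Sum>n\<in>tail_vectors k (k - d) m. tail_weight q k (k - d) n))"
    using Suc.prems tail_sum_recursion[of "k - Suc d" k q N] by simp
  also have "\<dots> = (\<Sum>r\<le>N. q ^ (r ^ 2 + r) * ((q ^ (r ^ 2 + r)) ^ d * seed_alpha q r) /
      (qpoch q q (N - r) * qpoch q q (N + r + 1)))"
    using Suc.prems by (intro Bailey_step[OF q] Suc.IH) simp
  finally show ?case
    by (simp add: mult.assoc)
qed

section \<open>The quadratic form\<close>

text \<open>Coefficients with \<open>\<Sum>\<^bsub>j\<le>m\<^esub> c\<^sub>j = 2 m - 1\<close> for \<open>m \<ge> 1\<close>. Since \<open>min (2 r - 1) (2 s - 1)\<close> is the sum of \<open>c\<^sub>j\<close> over
  \<open>j \<le> min r s\<close>, the quadratic form with these entries is the sum of the squares of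
  \<open>y\<^sub>j + \<cdots> + y\<^sub>K\<close> with coefficients \<open>c\<^sub>j\<close>.\<close>

definition min_weight :: "nat \<Rightarrow> real" where
  "min_weight j = (if j = 1 then 1 else 2)"

lemma sum_min_weight: "(\<Sum>j=1..K. min_weight j) = (if K = 0 then 0 else 2 * real K - 1)"
  by (induction K) (auto simp: min_weight_def)

lemma sum_min_weight_linear:
  "(\<Sum>j=1..K. min_weight j * (\<Sum>s=j..K. y s)) = (\<Sum>s=1..K. (2 * real s - 1) * y s)"
proof (induction K)
  case (Suc K)
  have "(\<Sum>j=1..Suc K. min_weight j * (\<Sum>s=j..Suc K. y s))
      = (\<Sum>j=1..Suc K. min_weight j * (\<Sum>s=j..K. y s) + min_weight j * y (Suc K))"
    by (rule sum.cong) (auto simp: distrib_left)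
  also have "\<dots> = (\<Sum>j=1..K. min_weight j * (\<Sum>s=j..K. y s)) + (\<Sum>j=1..Suc K. min_weight j) * y (Suc K)"
    by (simp only: sum.distrib sum_distrib_right[symmetric]) simp
  also have "\<dots> = (\<Sum>s=1..Suc K. (2 * real s - 1) * y s)"
    unfolding Suc.IH sum_min_weight by simp
  finally show ?case .
qed simp

lemma sum_min_weight_quadratic:
  "(\<Sum>j=1..K. min_weight j * (\<Sum>s=j..K. y s) ^ 2)
   = (\<Sum>r=1..K. \<Sum>s=1..K. y r * min (2 * real r - 1) (2 * real s - 1) * y s)"
proof (induction K)
  case (Suc K)
  let ?z = "y (Suc K)"
  have "(\<Sum>j=1..Suc K. min_weight j * (\<Sum>s=j..Suc K. y s) ^ 2)
      = (\<Sum>j=1..Suc K. min_weight j * (\<Sum>s=j..K. y s) ^ 2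
           + 2 * ?z * (min_weight j * (\<Sum>s=j..K. y s)) + min_weight j * ?z ^ 2)"
    by (rule sum.cong) (auto simp: power2_eq_square algebra_simps)
  also have "\<dots> = (\<Sum>j=1..K. min_weight j * (\<Sum>s=j..K. y s) ^ 2)
      + 2 * ?z * (\<Sum>j=1..K. min_weight j * (\<Sum>s=j..K. y s)) + (\<Sum>j=1..Suc K. min_weight j) * ?z ^ 2"
    by (simp only: sum.distrib sum_distrib_right[symmetric] sum_distrib_left[symmetric]) simp
  also have "\<dots> = (\<Sum>r=1..K. \<Sum>s=1..K. y r * min (2 * real r - 1) (2 * real s - 1) * y s)
      + 2 * ?z * (\<Sum>s=1..K. (2 * real s - 1) * y s) + (2 * real (Suc K) - 1) * ?z ^ 2"
    unfolding Suc.IH sum_min_weight_linear sum_min_weight by simp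
  also have "2 * ?z * (\<Sum>s=1..K. (2 * real s - 1) * y s)
      = (\<Sum>r=1..K. y r * min (2 * real r - 1) (2 * real (Suc K) - 1) * ?z)
      + (\<Sum>s=1..K. ?z * min (2 * real (Suc K) - 1) (2 * real s - 1) * y s)"
    unfolding sum_distrib_left sum.distrib[symmetric] by (rule sum.cong) (auto simp: min_def)
  finally show ?case
    by (simp add: sum.distrib power2_eq_square)
qed simp

text \<open>Merging the last two variables into their mean leaves the matrix of minima of size \<open>k\<close>, together
  with the square of their difference.\<close>

lemma Ainv_form_eq:
  assumes "k \<ge> 1" and y: "\<And>j. j < k \<Longrightarrow> y j = real (n j)" "y k = (real (n k) + real (n (k + 1))) / 2"
  shows "Ainv_form k n = (\<Sum>j=1..k. min_weight j * (\<Sum>s=j..k. y s) ^ 2)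
      + (real (n k) - real (n (k + 1))) ^ 2 / 2"
proof -
  obtain m where k: "k = Suc m"
    using assms(1) by (cases k) auto
  define a b where "a = real (n k)" and "b = real (n (k + 1))"
  define L where "L = (\<Sum>s=1..m. (2 * real s - 1) * y s)"
  define Q where "Q = (\<Sum>r=1..m. \<Sum>s=1..m. y r * min (2 * real r - 1) (2 * real s - 1) * y s)"
  have split: "(\<Sum>s=1..k+1. g s) = (\<Sum>s=1..m. g s) + g k + g (k + 1)" for g :: "nat \<Rightarrow> real"
    by (simp add: k)
  have "(\<Sum>s=1..k+1. real (n r) * Ainv k r s * real (n s))
      = (\<Sum>s=1..m. y r * min (2 * real r - 1) (2 * real s - 1) * y s) + (2 * real r - 1) * y r * ((a + b) / 2)"
    if "r \<in> {1..m}" for r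
  proof -
    have "(\<Sum>s=1..m. real (n r) * Ainv k r s * real (n s))
        = (\<Sum>s=1..m. y r * min (2 * real r - 1) (2 * real s - 1) * y s)"
      using that by (intro sum.cong refl) (auto simp: Ainv_def y(1) k)
    then show ?thesis
      unfolding split using that
      by (simp add: Ainv_def k a_def b_def y(1)) (simp add: field_simps)
  qed
  then have 1: "(\<Sum>r=1..m. \<Sum>s=1..k+1. real (n r) * Ainv k r s * real (n s)) = Q + L * ((a + b) / 2)"
    by (simp only: sum.distrib Q_def L_def sum_distrib_right cong: sum.cong)
  have 2: "(\<Sum>s=1..m. c * Ainv k r s * real (n s)) = c / 2 * L" if "k \<le> r" for r c
    unfolding L_def sum_distrib_left
    using that by (intro sum.cong refl) (auto simp: Ainv_def y(1) k)
  have "Ainv_form k n = Q + L * ((a + b) / 2)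
      + (a / 2 * L + a * ((2 * real k + 1) / 4) * a + a * ((2 * real k - 3) / 4) * b)
      + (b / 2 * L + b * ((2 * real k - 3) / 4) * a + b * ((2 * real k + 1) / 4) * b)"
    unfolding Ainv_form_def split[of "\<lambda>r. \<Sum>s=1..k+1. real (n r) * Ainv k r s * real (n s)"] 1
    unfolding split 2[OF order_refl] 2[OF le_add1]
    by (simp add: Ainv_def a_def b_def)
  also have "\<dots> = (Q + 2 * (L * ((a + b) / 2)) + (2 * real k - 1) * ((a + b) / 2) ^ 2) + (a - b) ^ 2 / 2"
    by (simp add: field_simps power2_eq_square)
  also have "Q + 2 * (L * ((a + b) / 2)) + (2 * real k - 1) * ((a + b) / 2) ^ 2
      = (\<Sum>r=1..k. \<Sum>s=1..k. y r * min (2 * real r - 1) (2 * real s - 1) * y s)"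
  proof -
    have "(\<Sum>r=1..m. y r * min (2 * real r - 1) (2 * real (Suc m) - 1) * y k) = L * y k"
      "(\<Sum>s=1..m. y k * min (2 * real (Suc m) - 1) (2 * real s - 1) * y s) = L * y k"
      unfolding L_def sum_distrib_right by (intro sum.cong refl; auto simp: min_def)+
    then show ?thesis
      unfolding y(2)[folded a_def b_def, symmetric] Q_def
      by (simp add: k sum.distrib power2_eq_square)
  qed
  finally show ?thesis
    unfolding sum_min_weight_quadratic a_def b_def .
qed

lemma triangle_real: "real (triangle n) = (real n ^ 2 + real n) / 2"
  by (induction n) (auto simp: power2_eq_square field_simps)

text \<open>The exponent of a summand is
  \<open>N\<^sub>1 (N\<^sub>1 + 1) / 2 + \<Sum>\<^bsub>2\<le>j\<le>k\<^esub> (N\<^sub>j\<^sup>2 + N\<^sub>j) + ((n\<^sub>k - n\<^bsub>k+1\<^esub>) / 2)\<^sup>2\<close>.\<close>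

lemma nahm_exponent:
  assumes "k \<ge> 1" and par: "[n k = n (k + 1)] (mod 2)"
  shows "1 / 2 * Ainv_form k n + (\<Sum>j=1..k-1. (2 * real j - 1) / 2 * real (n j))
      + (2 * real k - 1) / 4 * (real (n k) + real (n (k + 1)))
    = real (triangle (partial_total k 1 n)
        + ((\<Sum>j=Suc 1..k. partial_total k j n ^ 2 + partial_total k j n) + half_difference k n ^ 2))"
proof -
  obtain m where k: "k = Suc m"
    using assms(1) by (cases k) auto
  define y where "y j = (if j < k then real (n j) else (real (n k) + real (n (k + 1))) / 2)" for j
  define T where "T j = real (partial_total k j n)" for j
  have "even (n k + n (k + 1))"
    using par by (simp add: cong_2_iff_even_add)
  then have half: "real ((n k + n (k + 1)) div 2) = (real (n k) + real (n (k + 1))) / 2"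
    by (simp add: real_of_nat_div)
  have T: "(\<Sum>s=j..k. y s) = T j" if "j \<le> k" for j
  proof -
    have "(\<Sum>s=j..k. y s) = (\<Sum>s=j..<k. y s) + y k"
      using that by (simp add: sum.last_plus add.commute)
    also have "(\<Sum>s=j..<k. y s) = (\<Sum>s=j..<k. real (n s))"
      by (rule sum.cong) (auto simp: y_def)
    finally show ?thesis
      using half by (simp add: T_def partial_total_def y_def)
  qed
  have hd: "real (half_difference k n) ^ 2 = ((real (n k) - real (n (k + 1))) / 2) ^ 2"
  proof -
    have "real (half_difference k n) ^ 2 = (real (n k) - T k) ^ 2"
      by (simp add: half_difference_def T_def)
    also have "real (n k) - T k = (real (n k) - real (n (k + 1))) / 2"
      using half by (simp add: T_def partial_total_def field_simps)
    finally show ?thesis .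
  qed
  have A: "Ainv_form k n = (\<Sum>j=1..k. min_weight j * T j ^ 2) + (real (n k) - real (n (k + 1))) ^ 2 / 2"
  proof -
    have "Ainv_form k n = (\<Sum>j=1..k. min_weight j * (\<Sum>s=j..k. y s) ^ 2)
        + (real (n k) - real (n (k + 1))) ^ 2 / 2"
      by (rule Ainv_form_eq[OF assms(1)]) (simp_all add: y_def)
    also have "(\<Sum>j=1..k. min_weight j * (\<Sum>s=j..k. y s) ^ 2) = (\<Sum>j=1..k. min_weight j * T j ^ 2)"
      by (rule sum.cong) (auto simp: T)
    finally show ?thesis .
  qed
  have "(\<Sum>j=1..k-1. (2 * real j - 1) / 2 * real (n j)) + (2 * real k - 1) / 4 * (real (n k) + real (n (k + 1)))
      = 1 / 2 * (\<Sum>s=1..k. (2 * real s - 1) * y s)"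
  proof -
    have "(\<Sum>j=1..m. (2 * real j - 1) / 2 * real (n j)) = 1 / 2 * (\<Sum>s=1..m. (2 * real s - 1) * y s)"
      unfolding sum_distrib_left by (rule sum.cong) (auto simp: y_def k)
    then show ?thesis
      by (simp add: k y_def[of "Suc m"] field_simps)
  qed
  also have "(\<Sum>s=1..k. (2 * real s - 1) * y s) = (\<Sum>j=1..k. min_weight j * T j)"
    unfolding sum_min_weight_linear[symmetric] by (rule sum.cong) (auto simp: T)
  finally have B: "(\<Sum>j=1..k-1. (2 * real j - 1) / 2 * real (n j))
      + (2 * real k - 1) / 4 * (real (n k) + real (n (k + 1)))
      = 1 / 2 * (\<Sum>j=1..k. min_weight j * T j)" .
  have split: "(\<Sum>j=1..k. min_weight j * g j) = g 1 + 2 * (\<Sum>j=Suc 1..k. g j)" for g :: "nat \<Rightarrow> real"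
  proof -
    have "(\<Sum>j=1..k. min_weight j * g j) = g 1 + (\<Sum>j=Suc 1..k. min_weight j * g j)"
      using assms(1) by (subst sum.atLeast_Suc_atMost) (auto simp: min_weight_def)
    also have "(\<Sum>j=Suc 1..k. min_weight j * g j) = 2 * (\<Sum>j=Suc 1..k. g j)"
      unfolding sum_distrib_left by (rule sum.cong) (auto simp: min_weight_def)
    finally show ?thesis .
  qed
  have R: "real (triangle (partial_total k 1 n)
        + ((\<Sum>j=Suc 1..k. partial_total k j n ^ 2 + partial_total k j n) + half_difference k n ^ 2))
      = (T 1 ^ 2 + T 1) / 2 + ((\<Sum>j=Suc 1..k. T j ^ 2) + (\<Sum>j=Suc 1..k. T j))
        + real (half_difference k n) ^ 2"
    by (simp add: triangle_real T_def sum.distrib)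
  show ?thesis
    unfolding R hd add.assoc B unfolding A split
    by (simp add: power_divide add_divide_distrib)
qed

section \<open>Interchange of summation and the theta series\<close>

lemma qpow_add: "qpow \<tau> (r + s) = qpow \<tau> r * qpow \<tau> s"
  by (simp add: qpow_def exp_add[symmetric] algebra_simps)

lemma qpow_of_nat: "qpow \<tau> (real n) = qpow \<tau> 1 ^ n"
  by (simp add: qpow_def exp_of_nat_mult[symmetric] mult_ac)

lemma norm_qpow_1_less:
  assumes "Im \<tau> > 0"
  shows "norm (qpow \<tau> 1) < 1"
  using assms by (simp add: qpow_def)

lemma nahm_summand_eq:
  assumes "k \<ge> 1" "n \<in> index_vectors k"
  shows "nahm_summand \<tau> k n
    = qpow \<tau> 1 ^ triangle (partial_total k 1 n) * qpoch (- qpow \<tau> 1) (qpow \<tau> 1) (partial_total k 1 n)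
        * tail_weight (qpow \<tau> 1) k 1 n"
proof -
  have par: "[n k = n (k + 1)] (mod 2)"
    using assms by (simp add: index_vectors_def)
  have "{1..k-1} = {1..<k}"
    by auto
  then have "(\<Sum>j=1..k-1. n j) + (n k + n (k + 1)) div 2 = partial_total k 1 n"
    by (simp add: partial_total_def)
  then show ?thesis
    unfolding nahm_summand_def Let_def nahm_exponent[of k n, OF assms(1) par] qpow_of_nat
    by (simp add: tail_weight_def power_add)
qed

lemma summable_prod_power_PiE:
  fixes s :: real
  assumes "finite A" "0 \<le> s" "s < 1"
  shows "(\<lambda>n. \<Prod>j\<in>A. s ^ n j) summable_on (A \<rightarrow>\<^sub>E (UNIV :: nat set))"
proof (rule nonneg_bdd_above_summable_on)
  show "bdd_above (sum (\<lambda>n. \<Prod>j\<in>A. s ^ n j) ` {F. F \<subseteq> A \<rightarrow>\<^sub>E UNIV \<and> finite F})"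
  proof (rule bdd_aboveI2)
    fix F :: "('a \<Rightarrow> nat) set" assume "F \<in> {F. F \<subseteq> A \<rightarrow>\<^sub>E UNIV \<and> finite F}"
    then have F: "F \<subseteq> A \<rightarrow>\<^sub>E UNIV" "finite F"
      by auto
    define m where "m = Max (insert 0 ((\<lambda>(n, j). n j) ` (F \<times> A)))"
    have le: "n j \<le> m" if "n \<in> F" "j \<in> A" for n j
      unfolding m_def
    proof (rule Max_ge)
      show "finite (insert 0 ((\<lambda>(n, j). n j) ` (F \<times> A)))"
        using F assms by simp
      show "n j \<in> insert 0 ((\<lambda>(n, j). n j) ` (F \<times> A))"
        using that by (intro insertI2 image_eqI[of _ _ "(n, j)"]) auto
    qed
    have "F \<subseteq> A \<rightarrow>\<^sub>E {..m}"
    proof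
      fix n assume n: "n \<in> F"
      then have "n \<in> extensional A"
        using F(1) by (meson PiE_iff subsetD)
      then show "n \<in> A \<rightarrow>\<^sub>E {..m}"
        unfolding PiE_iff using le[OF n] by simp
    qed
    then have "(\<Sum>n\<in>F. \<Prod>j\<in>A. s ^ n j) \<le> (\<Sum>n\<in>A \<rightarrow>\<^sub>E {..m}. \<Prod>j\<in>A. s ^ n j)"
      using assms by (intro sum_mono2 finite_PiE prod_nonneg) auto
    also have "\<dots> = (\<Prod>j\<in>A. \<Sum>i\<le>m. s ^ i)"
      using assms by (intro prod_sum_PiE[symmetric]) auto
    also have "\<dots> \<le> (\<Prod>j\<in>A. 1 / (1 - s))"
    proof (intro prod_mono conjI sum_nonneg)
      have "(\<Sum>i\<le>m. s ^ i) \<le> (\<Sum>i. s ^ i)"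
        using assms by (intro sum_le_suminf summable_geometric) auto
      then show "(\<Sum>i\<le>m. s ^ i) \<le> 1 / (1 - s)"
        using assms by (simp add: suminf_geometric)
    qed (use assms in auto)
    finally show "(\<Sum>n\<in>F. \<Prod>j\<in>A. s ^ n j) \<le> (\<Prod>j\<in>A. 1 / (1 - s))" .
  qed
qed (use assms in \<open>auto intro!: prod_nonneg\<close>)

text \<open>The exponent is at least \<open>N\<^sub>1\<close>, hence at least half of the sum of all entries, so the summand is
  bounded by a constant times a product of geometric terms with ratio \<open>\<bar>q\<bar>\<^bsup>1/2\<^esup>\<close>.\<close>

lemma nahm_summand_summable:
  assumes \<tau>: "Im \<tau> > 0" and k: "k \<ge> 1"
  shows "nahm_summand \<tau> k summable_on index_vectors k"
proof -
  define q where "q = qpow \<tau> 1"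
  have q: "norm q < 1"
    using norm_qpow_1_less[OF \<tau>] by (simp add: q_def)
  define s where "s = sqrt (norm q)"
  have s: "0 \<le> s" "s < 1" "norm q = s ^ 2"
    using q by (auto simp: s_def)
  obtain C where C: "C > 0" "\<And>n. norm (qpoch (- q) q n) \<le> C" "\<And>n. norm (1 / qpoch q q n) \<le> C"
    using qpoch_bounds[OF q] by blast
  have "(\<lambda>n. C * C ^ (k + 1) * (\<Prod>j\<in>{1..k+1}. s ^ n j)) summable_on ({1..k+1} \<rightarrow>\<^sub>E UNIV)"
    using s by (intro summable_on_cmult_right summable_prod_power_PiE) auto
  then have "(\<lambda>n. C * C ^ (k + 1) * (\<Prod>j\<in>{1..k+1}. s ^ n j)) summable_on index_vectors k"
    by (rule summable_on_subset_banach) (auto simp: index_vectors_def)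
  then have "(\<lambda>n. norm (nahm_summand \<tau> k n)) summable_on index_vectors k"
  proof (rule Infinite_Sum.abs_summable_on_comparison_test')
    fix n assume n: "n \<in> index_vectors k"
    define N where "N = partial_total k 1 n"
    define e where "e = triangle N
        + ((\<Sum>j=Suc 1..k. partial_total k j n ^ 2 + partial_total k j n) + half_difference k n ^ 2)"
    have eq: "nahm_summand \<tau> k n = qpoch (- q) q N * (\<Prod>j=1..k+1. 1 / qpoch q q (n j)) * q ^ e"
      unfolding nahm_summand_eq[OF k n] q_def[symmetric]
      by (simp add: tail_weight_def N_def e_def power_add prod_dividef)
    have "even (n k + n (k + 1))"
      using n by (simp add: index_vectors_def cong_2_iff_even_add)
    then have total: "2 * ((n k + n (k + 1)) div 2) = n k + n (k + 1)"
      by simp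
    have "{1..k+1} = {1..<k} \<union> {k, k + 1}"
      using k by auto
    then have "(\<Sum>j=1..k+1. n j) = (\<Sum>j=1..<k. n j) + (n k + n (k + 1))"
      by (simp only:) (subst sum.union_disjoint, auto)
    also have "\<dots> \<le> 2 * N"
      unfolding N_def partial_total_def distrib_left total by simp
    also have "\<dots> \<le> 2 * e"
      using triangle_ge[of N] by (simp add: e_def)
    finally have e: "(\<Sum>j=1..k+1. n j) \<le> 2 * e" .
    have "norm (nahm_summand \<tau> k n)
        = norm (qpoch (- q) q N) * (\<Prod>j=1..k+1. norm (1 / qpoch q q (n j))) * s ^ (2 * e)"
      unfolding eq by (simp only: norm_mult prod_norm[symmetric] norm_power s(3) power_mult)
    also have "\<dots> \<le> C * (\<Prod>j=1..k+1. C) * s ^ (\<Sum>j=1..k+1. n j)"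
      using C(1) s e
      by (intro mult_mono C mult_nonneg_nonneg power_decreasing prod_mono prod_nonneg conjI) auto
    also have "\<dots> = C * C ^ (k + 1) * (\<Prod>j\<in>{1..k+1}. s ^ n j)"
      by (simp only: power_sum prod_constant card_atLeastAtMost) simp
    finally show "norm (nahm_summand \<tau> k n) \<le> C * C ^ (k + 1) * (\<Prod>j\<in>{1..k+1}. s ^ n j)" .
  qed
  then show ?thesis
    by (rule abs_summable_summable)
qed

lemma tail_vectors_1_iff:
  "n \<in> tail_vectors k 1 N \<longleftrightarrow> n \<in> index_vectors k \<and> partial_total k 1 n = N"
  unfolding tail_vectors_def index_vectors_def by blast

lemma nahm_sum_by_total:
  assumes \<tau>: "Im \<tau> > 0" and k: "k \<ge> 1" and q: "q = qpow \<tau> 1"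
    and S: "(nahm_summand \<tau> k has_sum S) (index_vectors k)"
  shows "((\<lambda>N. \<Sum>r\<le>N. (q ^ (r ^ 2 + r)) ^ (k - 1) * seed_alpha q r * q ^ triangle r
             * Gauss_term q r (N - r)) has_sum S) UNIV"
proof -
  have q1: "norm q < 1"
    using norm_qpow_1_less[OF \<tau>] by (simp add: q)
  have "bij_betw snd (Sigma UNIV (tail_vectors k 1)) (index_vectors k)"
    by (rule bij_betwI[where g = "\<lambda>n. (partial_total k 1 n, n)"])
       (auto simp: tail_vectors_1_iff simp del: One_nat_def)
  then have "((\<lambda>p. nahm_summand \<tau> k (snd p)) has_sum S) (Sigma UNIV (tail_vectors k 1))"
    using S by (simp only: has_sum_reindex_bij_betw)
  then have "((\<lambda>N. \<Sum>n\<in>tail_vectors k 1 N. nahm_summand \<tau> k n) has_sum S) UNIV"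
    by (rule has_sum_SigmaD) (simp add: has_sum_finite finite_tail_vectors)
  moreover have "(\<Sum>n\<in>tail_vectors k 1 N. nahm_summand \<tau> k n)
      = (\<Sum>r\<le>N. (q ^ (r ^ 2 + r)) ^ (k - 1) * seed_alpha q r * q ^ triangle r * Gauss_term q r (N - r))" for N
  proof -
    have "(\<Sum>n\<in>tail_vectors k 1 N. nahm_summand \<tau> k n)
        = (\<Sum>n\<in>tail_vectors k 1 N. q ^ triangle N * qpoch (- q) q N * tail_weight q k 1 n)"
    proof (rule sum.cong)
      fix n assume "n \<in> tail_vectors k 1 N"
      then have "n \<in> index_vectors k" "partial_total k 1 n = N"
        by (simp_all add: tail_vectors_1_iff del: One_nat_def)
      then show "nahm_summand \<tau> k n = q ^ triangle N * qpoch (- q) q N * tail_weight q k 1 n"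
        using nahm_summand_eq[OF k] by (simp add: q)
    qed simp
    also have "\<dots> = q ^ triangle N * qpoch (- q) q N * (\<Sum>r\<le>N. (q ^ (r ^ 2 + r)) ^ (k - 1) *
        seed_alpha q r / (qpoch q q (N - r) * qpoch q q (N + r + 1)))"
      using tail_sum_eq[OF q1, of "k - 1" k N] k by (simp add: sum_distrib_left[symmetric])
    also have "\<dots> = (\<Sum>r\<le>N. (q ^ (r ^ 2 + r)) ^ (k - 1) * seed_alpha q r * q ^ triangle r
        * Gauss_term q r (N - r))"
      unfolding sum_distrib_left
    proof (rule sum.cong)
      fix r assume "r \<in> {..N}"
      then obtain j where N: "N = r + j"
        using le_Suc_ex by auto
      have eq: "N + r + 1 = 2 * r + 1 + j"
        by (simp add: N)
      show "q ^ triangle N * qpoch (- q) q N * ((q ^ (r ^ 2 + r)) ^ (k - 1) *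
          seed_alpha q r / (qpoch q q (N - r) * qpoch q q (N + r + 1)))
        = (q ^ (r ^ 2 + r)) ^ (k - 1) * seed_alpha q r * q ^ triangle r * Gauss_term q r (N - r)"
        unfolding eq by (simp add: N Gauss_term_def triangle_add power_add)
    qed simp
    finally show ?thesis .
  qed
  ultimately show ?thesis
    by simp
qed

text \<open>The summand of the theta series at \<open>n = r \<ge> 0\<close>, without the constant power of \<open>q\<close>. The exponent is
  \<open>((2 k + 1) r\<^sup>2 + (2 k - 1) r) / 2\<close>, written as a natural number for \<open>k \<ge> 1\<close> in the shape in which the
  Bailey chain produces it.\<close>

definition theta_coeff :: "complex \<Rightarrow> nat \<Rightarrow> nat \<Rightarrow> complex" where
  "theta_coeff q k r = of_nat (2 * r + 1) * (q ^ ((k - 1) * (r ^ 2 + r) + r ^ 2 + triangle r))"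

lemma theta_coeff_eq:
  "(q ^ (r ^ 2 + r)) ^ (k - 1) * seed_alpha q r * q ^ triangle r
     = theta_coeff q k r * (1 - q ^ (2 * r + 1))"
  unfolding power_mult[symmetric] mult.commute[of "r ^ 2 + r"]
  by (simp add: theta_coeff_def seed_alpha_def power_add mult_ac)

lemma norm_theta_coeff_le:
  assumes "norm q < 1"
  shows "norm (theta_coeff q k r) \<le> real (2 * r + 1) * norm q ^ r"
proof -
  have "norm (theta_coeff q k r) = real (2 * r + 1) * norm q ^ ((k - 1) * (r ^ 2 + r) + r ^ 2 + triangle r)"
    by (simp only: theta_coeff_def norm_mult norm_power norm_of_nat)
  also have "\<dots> \<le> real (2 * r + 1) * norm q ^ r"
    using assms triangle_ge[of r] by (intro mult_left_mono power_decreasing) auto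
  finally show ?thesis .
qed

lemma summable_odd_geometric:
  fixes x :: real
  assumes "0 \<le> x" "x < 1"
  shows "(\<lambda>r. real (2 * r + 1) * x ^ r) summable_on UNIV"
proof (rule summable_nonneg_imp_summable_on)
  have "summable (\<lambda>r. real (Suc r) * x ^ r)"
    using geometric_deriv_sums[of x] assms by (auto simp: sums_iff)
  then have "summable (\<lambda>r. 2 * (real (Suc r) * x ^ r))"
    by (rule summable_mult)
  then show "summable (\<lambda>r. real (2 * r + 1) * x ^ r)"
  proof (rule summable_comparison_test'[where N = 0])
    fix r
    have "norm (real (2 * r + 1) * x ^ r) = real (2 * r + 1) * x ^ r"
      using assms by (simp add: abs_mult)
    also have "\<dots> \<le> (2 * real (Suc r)) * x ^ r"
      using assms by (intro mult_right_mono) auto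
    finally show "norm (real (2 * r + 1) * x ^ r) \<le> 2 * (real (Suc r) * x ^ r)"
      by (simp only: mult.assoc)
  qed
qed (use assms in auto)

lemma theta_coeff_summable:
  assumes "norm q < 1"
  shows "theta_coeff q k summable_on UNIV"
    and "(\<lambda>r. theta_coeff q k r * q ^ (2 * r + 1)) summable_on UNIV"
proof -
  note bd = norm_theta_coeff_le[OF assms, of k]
  have S: "(\<lambda>r. real (2 * r + 1) * norm q ^ r) summable_on UNIV"
    using assms by (intro summable_odd_geometric) auto
  show "theta_coeff q k summable_on UNIV"
    by (intro abs_summable_summable[OF Infinite_Sum.abs_summable_on_comparison_test'[OF S]] bd)
  have "norm (theta_coeff q k r * q ^ (2 * r + 1)) \<le> real (2 * r + 1) * norm q ^ r" for r
  proof -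
    have "norm (theta_coeff q k r) * norm q ^ (2 * r + 1) \<le> norm (theta_coeff q k r) * 1"
      using assms by (intro mult_left_mono power_le_one) auto
    then show ?thesis
      using bd[of r] by (simp add: norm_mult norm_power)
  qed
  then show "(\<lambda>r. theta_coeff q k r * q ^ (2 * r + 1)) summable_on UNIV"
    by (intro abs_summable_summable[OF Infinite_Sum.abs_summable_on_comparison_test'[OF S]])
qed

text \<open>The outermost sum, over \<open>N = N\<^sub>1\<close>, is interchanged with the sum over \<open>r \<le> N\<close> and then evaluated
  by the limiting q-Gauss sum.\<close>

lemma nahm_sum_eq:
  assumes \<tau>: "Im \<tau> > 0" and k: "k \<ge> 1" and q: "q = qpow \<tau> 1"
  shows "((\<lambda>r. theta_coeff q k r * (1 - q ^ (2 * r + 1)) * (qpoch_inf (- q) q / qpoch_inf q q))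
    has_sum (\<Sum>\<^sub>\<infinity>n\<in>index_vectors k. nahm_summand \<tau> k n)) UNIV"
proof -
  have q1: "norm q < 1"
    using norm_qpow_1_less[OF \<tau>] by (simp add: q)
  define S where "S = (\<Sum>\<^sub>\<infinity>n\<in>index_vectors k. nahm_summand \<tau> k n)"
  define a where "a r = theta_coeff q k r * (1 - q ^ (2 * r + 1))" for r
  have S: "((\<lambda>N. \<Sum>r\<le>N. a r * Gauss_term q r (N - r)) has_sum S) UNIV"
    using nahm_sum_by_total[OF \<tau> k q has_sum_infsum[OF nahm_summand_summable[OF \<tau> k]]]
    unfolding theta_coeff_eq a_def S_def .
  obtain C where C: "\<And>r j. norm (Gauss_term q r j) \<le> C * norm q ^ j"
    using norm_Gauss_term_le[OF q1] by blast
  have "norm (Gauss_term q 0 0) \<le> C"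
    using C[of 0 0] by simp
  then have C0: "C \<ge> 0"
    using norm_ge_zero order_trans by blast
  have geo: "(\<lambda>j. norm q ^ j) summable_on UNIV"
    using q1 by (intro summable_nonneg_imp_summable_on summable_geometric) auto
  have odd: "(\<lambda>r. real (2 * r + 1) * norm q ^ r) summable_on UNIV"
    using q1 by (intro summable_odd_geometric) auto
  have "(\<lambda>(r, j). (real (2 * r + 1) * norm q ^ r) * norm q ^ j) summable_on UNIV \<times> UNIV"
  proof (rule summable_on_SigmaI)
    show "((\<lambda>j. case (r, j) of (r, j) \<Rightarrow> (real (2 * r + 1) * norm q ^ r) * norm q ^ j) has_sum
        (real (2 * r + 1) * norm q ^ r) * (\<Sum>\<^sub>\<infinity>j. norm q ^ j)) UNIV" for r
      unfolding prod.case by (intro has_sum_cmult_right has_sum_infsum geo)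
    show "(\<lambda>r. (real (2 * r + 1) * norm q ^ r) * (\<Sum>\<^sub>\<infinity>j. norm q ^ j)) summable_on UNIV"
      by (rule summable_on_cmult_left[OF odd])
  qed auto
  then have "(\<lambda>p. 2 * C * (case p of (r, j) \<Rightarrow> (real (2 * r + 1) * norm q ^ r) * norm q ^ j))
      summable_on UNIV \<times> UNIV"
    by (rule summable_on_cmult_right)
  then have "(\<lambda>p. norm (case p of (r, j) \<Rightarrow> a r * Gauss_term q r j)) summable_on UNIV \<times> UNIV"
  proof (rule Infinite_Sum.abs_summable_on_comparison_test')
    fix p :: "nat \<times> nat"
    obtain r j where p: "p = (r, j)"
      by force
    have "norm (1 - q ^ (2 * r + 1)) \<le> 1 + norm q ^ (2 * r + 1)"
      by (metis norm_one norm_power norm_triangle_ineq4)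
    also have "\<dots> \<le> 2"
      using q1 power_le_one[of "norm q" "2 * r + 1"] by simp
    finally have "norm (a r * Gauss_term q r j) \<le> (real (2 * r + 1) * norm q ^ r) * 2 * (C * norm q ^ j)"
      unfolding a_def norm_mult
      by (intro mult_mono norm_theta_coeff_le q1 C mult_nonneg_nonneg) (use C0 in auto)
    also have "\<dots> = 2 * C * (real (2 * r + 1) * norm q ^ r * norm q ^ j)"
      by simp
    finally show "norm (case p of (r, j) \<Rightarrow> a r * Gauss_term q r j)
        \<le> 2 * C * (case p of (r, j) \<Rightarrow> (real (2 * r + 1) * norm q ^ r) * norm q ^ j)"
      by (simp add: p)
  qed
  then have summ: "(\<lambda>(r, j). a r * Gauss_term q r j) summable_on UNIV \<times> UNIV"
    by (rule abs_summable_summable)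
  then obtain S' where S': "((\<lambda>(r, j). a r * Gauss_term q r j) has_sum S') (UNIV \<times> UNIV)"
    by (auto simp: summable_on_def)
  have "bij_betw (\<lambda>(N, r). (r, N - r)) (Sigma UNIV (\<lambda>N. {..N :: nat})) (UNIV \<times> UNIV)"
    by (rule bij_betwI[where g = "\<lambda>(r, j). (r + j, r)"]) auto
  from has_sum_reindex_bij_betw[OF this] S'
  have "((\<lambda>p. case (case p of (N, r) \<Rightarrow> (r, N - r)) of (r, j) \<Rightarrow> a r * Gauss_term q r j) has_sum S')
      (Sigma UNIV (\<lambda>N. {..N}))"
    by blast
  then have "((\<lambda>N. \<Sum>r\<le>N. a r * Gauss_term q r (N - r)) has_sum S') UNIV"
    by (rule has_sum_SigmaD) (simp add: has_sum_finite)
  then have "S' = S"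
    using S has_sum_unique by blast
  moreover have "((\<lambda>r. a r * (qpoch_inf (- q) q / qpoch_inf q q)) has_sum S') UNIV"
  proof (rule has_sum_SigmaD[OF S'])
    fix r
    have "(Gauss_term q r has_sum (qpoch_inf (- q) q / qpoch_inf q q)) UNIV"
    proof (rule norm_summable_imp_has_sum)
      show "summable (\<lambda>j. norm (Gauss_term q r j))"
        by (rule summable_comparison_test'[of "\<lambda>j. C * norm q ^ j" 0])
           (use q1 C in \<open>auto intro!: summable_mult summable_geometric\<close>)
    qed (rule Gauss_term_sums[OF q1])
    then show "((\<lambda>j. case (r, j) of (r, j) \<Rightarrow> a r * Gauss_term q r j) has_sum
        a r * (qpoch_inf (- q) q / qpoch_inf q q)) UNIV"
      by (simp only: prod.case) (rule has_sum_cmult_right)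
  qed
  ultimately show ?thesis
    by (simp only: a_def S_def)
qed

text \<open>The integers \<open>m\<close> and \<open>- m - 1\<close>, for \<open>m \<ge> 0\<close>, are paired: their factors \<open>2 n + 1\<close> are opposite and
  their exponents differ by \<open>2 m + 1\<close>.\<close>

lemma theta_sum_eq:
  assumes \<tau>: "Im \<tau> > 0" and k: "k \<ge> 1" and q: "q = qpow \<tau> 1"
  shows "(theta_summand \<tau> k has_sum
      qpow \<tau> ((2 * real k - 1) ^ 2 / (8 * (2 * real k + 1))) *
      (\<Sum>\<^sub>\<infinity>r. theta_coeff q k r * (1 - q ^ (2 * r + 1)))) UNIV"
proof -
  define D where "D = qpow \<tau> ((2 * real k - 1) ^ 2 / (8 * (2 * real k + 1)))"
  have q1: "norm q < 1"
    using norm_qpow_1_less[OF \<tau>] by (simp add: q)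
  have expo: "(2 * real k + 1) / 2 * (x + (2 * real k - 1) / (2 * (2 * real k + 1))) ^ 2
      = (2 * real k - 1) ^ 2 / (8 * (2 * real k + 1)) + ((2 * real k + 1) * x ^ 2 + (2 * real k - 1) * x) / 2"
    for x :: real
  proof -
    have "c / 2 * (x + d / (2 * c)) ^ 2 = d ^ 2 / (8 * c) + (c * x ^ 2 + d * x) / 2" if "c \<noteq> 0" for c d :: real
      using that by (simp add: field_simps power2_eq_square)
    from this[of "2 * real k + 1" "2 * real k - 1"] show ?thesis
      by linarith
  qed
  have e: "real ((k - 1) * (m ^ 2 + m) + m ^ 2 + triangle m)
      = ((2 * real k + 1) * real m ^ 2 + (2 * real k - 1) * real m) / 2" for m
    using k by (simp add: triangle_real of_nat_diff field_simps)
  have nonneg: "theta_summand \<tau> k (int m) = D * theta_coeff q k m" for m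
    unfolding theta_summand_def expo qpow_add D_def[symmetric] of_int_of_nat_eq e[symmetric] qpow_of_nat
    by (simp add: theta_coeff_def q)
  have neg: "theta_summand \<tau> k (- int m - 1) = - D * (theta_coeff q k m * q ^ (2 * m + 1))" for m
  proof -
    have "((2 * real k + 1) * real_of_int (- int m - 1) ^ 2 + (2 * real k - 1) * real_of_int (- int m - 1)) / 2
        = real ((k - 1) * (m ^ 2 + m) + m ^ 2 + triangle m) + real (2 * m + 1)"
      unfolding e by (simp add: field_simps power2_eq_square)
    then show ?thesis
      unfolding theta_summand_def expo qpow_add D_def[symmetric]
      by (simp only: qpow_add qpow_of_nat) (simp add: theta_coeff_def q algebra_simps)
  qed
  define A where "A = (\<Sum>\<^sub>\<infinity>r. theta_coeff q k r)"
  define B where "B = (\<Sum>\<^sub>\<infinity>r. theta_coeff q k r * q ^ (2 * r + 1))"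
  have A: "(theta_coeff q k has_sum A) UNIV"
    and B: "((\<lambda>r. theta_coeff q k r * q ^ (2 * r + 1)) has_sum B) UNIV"
    unfolding A_def B_def by (intro has_sum_infsum theta_coeff_summable q1)+
  have "((\<lambda>m. theta_summand \<tau> k (int m)) has_sum D * A) UNIV"
    unfolding nonneg by (rule has_sum_cmult_right[OF A])
  moreover have "bij_betw int UNIV {0..}"
    by (rule bij_betwI[where g = nat]) auto
  ultimately have 1: "(theta_summand \<tau> k has_sum D * A) {0..}"
    by (simp only: has_sum_reindex_bij_betw)
  have "((\<lambda>m. theta_summand \<tau> k (- int m - 1)) has_sum - D * B) UNIV"
    unfolding neg by (rule has_sum_cmult_right[OF B])
  moreover have "bij_betw (\<lambda>m. - int m - 1) UNIV {..<0}"
    by (rule bij_betwI[where g = "\<lambda>n. nat (- n - 1)"]) auto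
  ultimately have 2: "(theta_summand \<tau> k has_sum - D * B) {..<0}"
    by (simp only: has_sum_reindex_bij_betw[where g = "\<lambda>m. - int m - 1"])
  have "(theta_summand \<tau> k has_sum D * A + - D * B) ({0..} \<union> {..<0})"
    by (rule has_sum_Un_disjoint[OF 1 2]) auto
  moreover have "{0..} \<union> {..<0} = (UNIV :: int set)"
    by auto
  moreover have "(\<Sum>\<^sub>\<infinity>r. theta_coeff q k r * (1 - q ^ (2 * r + 1))) = A - B"
  proof (rule infsumI)
    have "((\<lambda>r. theta_coeff q k r + - 1 * (theta_coeff q k r * q ^ (2 * r + 1))) has_sum A + - 1 * B) UNIV"
      by (intro has_sum_add A has_sum_cmult_right B)
    then show "((\<lambda>r. theta_coeff q k r * (1 - q ^ (2 * r + 1))) has_sum A - B) UNIV"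
      by (simp add: algebra_simps)
  qed
  moreover have "D * A + - D * B = D * (A - B)"
    by (simp add: algebra_simps)
  ultimately show ?thesis
    unfolding D_def[symmetric] by (simp only:)
qed

theorem theorem4p4:
  fixes \<tau> q :: complex and k :: nat
  assumes "Im \<tau> > 0" and "q = exp (2 * of_real pi * \<i> * \<tau>)" and "k \<ge> 1"
  shows "theta_summand \<tau> k summable_on UNIV
    \<and> nahm_summand \<tau> k summable_on index_vectors k
    \<and> qpow \<tau> (- ((2 * real k - 1) ^ 2 / (8 * (2 * real k + 1))))
        * (qpoch_inf (- q) q / qpoch_inf q q)
        * (\<Sum>\<^sub>\<infinity>n\<in>(UNIV :: int set). theta_summand \<tau> k n)
      = (\<Sum>\<^sub>\<infinity>n\<in>index_vectors k. nahm_summand \<tau> k n)"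
proof (intro conjI)
  let ?c = "(2 * real k - 1) ^ 2 / (8 * (2 * real k + 1))"
  let ?P = "qpoch_inf (- q) q / qpoch_inf q q"
  let ?X = "\<Sum>\<^sub>\<infinity>r. theta_coeff q k r * (1 - q ^ (2 * r + 1))"
  have q: "q = qpow \<tau> 1"
    using assms(2) by (simp add: qpow_def)
  note theta = theta_sum_eq[OF assms(1,3) q]
  show "theta_summand \<tau> k summable_on UNIV"
    using theta by (rule has_sum_imp_summable)
  show "nahm_summand \<tau> k summable_on index_vectors k"
    by (rule nahm_summand_summable[OF assms(1,3)])
  have "(\<Sum>\<^sub>\<infinity>n\<in>index_vectors k. nahm_summand \<tau> k n)
      = (\<Sum>\<^sub>\<infinity>r. theta_coeff q k r * (1 - q ^ (2 * r + 1)) * ?P)"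
    using nahm_sum_eq[OF assms(1,3) q] by (rule infsumI[symmetric])
  also have "\<dots> = ?X * ?P"
    by (rule infsum_cmult_left')
  finally have "(\<Sum>\<^sub>\<infinity>n\<in>index_vectors k. nahm_summand \<tau> k n) = ?X * ?P" .
  moreover have "(\<Sum>\<^sub>\<infinity>n. theta_summand \<tau> k n) = qpow \<tau> ?c * ?X"
    using theta by (rule infsumI)
  moreover have "qpow \<tau> (- ?c) * qpow \<tau> ?c = 1"
    unfolding qpow_add[symmetric] by (simp add: qpow_def)
  ultimately show "qpow \<tau> (- ?c) * ?P * (\<Sum>\<^sub>\<infinity>n\<in>(UNIV :: int set). theta_summand \<tau> k n)
      = (\<Sum>\<^sub>\<infinity>n\<in>index_vectors k. nahm_summand \<tau> k n)"
    by (simp add: mult_ac)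
qed

end
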